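(* Let $\lambda:\mathfrak g\to\mathfrak g\wedge\mathfrak g$ be the cobracket of the tangent Poisson-Lie algebra of a Poisson-Lie group $(G,m,\Lambda)$. Then $$d_T\lambda:T\mathfrak g\to T\mathfrak g\wedge T\mathfrak g$$ is the cobracket of the tangent Poisson-Lie algebra of the tangent Poisson-Lie group $(TG,Tm,d_T\Lambda)$. The dual mapping $$(d_T\lambda)^*:(T\mathfrak g)^*\wedge(T\mathfrak g)^*\to(T\mathfrak g)^*$$ is the Lie bracket on the tangent Lie algebra of $(\mathfrak g^*,\lambda^* )$.
   Context: Everything is smooth. A Poisson-Lie group $(G,m,\Lambda)$ is a Lie group with a bivector field $\Lambda$, $[\Lambda,\Lambda]=0$ (Schouten bracket), such that $m:(G\times G,\Lambda\oplus\Lambda)\to(G,\Lambda)$ is a Poisson map, i.e. $\bigwedge^2Tm\circ(\Lambda\oplus\Lambda)=\Lambda\circ m$. $\mathfrak g=T_eG$ is the Lie algebra of $G$. Tangent Poisson-Lie algebra: using right translations, regard $\Lambda$ as a map $\bar\Lambda:G\to\mathfrak g\wedge\mathfrak g$. Multiplicativity gives $\bar\Lambda(e)=0$. The cobracket is the derivative $\lambda=T_e\bar\Lambda:\mathfrak g\to\mathfrak g\wedge\mathfrak g$; it is a $1$-cocycle, and its dual $\lambda^*:\mathfrak g^*\wedge\mathfrak g^*\to\mathfrak g^*$ is a Lie bracket on $\mathfrak g^*$. The pair $(\mathfrak g,\lambda)$ is the tangent Poisson-Lie algebra of $(G,m,\Lambda)$. Tangent lift of a bivector field: for $\Lambda=\frac12\Lambda^{ij}\partial_{x^i}\wedge\partial_{x^j}$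 ($\Lambda^{ij}=-\Lambda^{ji}$) on a manifold $M$, $d_T\Lambda=\Lambda^{ij}\partial_{x^i}\wedge\partial_{\dot x^j}+\frac12\frac{\partial\Lambda^{ij}}{\partial x^k}\dot x^k\partial_{\dot x^i}\wedge\partial_{\dot x^j}$ in the induced coordinates $(x^i,\dot x^j)$ on $TM$. With this, $(TG,Tm,d_T\Lambda)$ is a Poisson-Lie group. Meaning of $d_T\lambda$: the linear map $\lambda:\mathfrak g\to\mathfrak g\wedge\mathfrak g$ is regarded as a (linear) bivector field on the vector space $\mathfrak g$; its tangent lift is a linear bivector field on the vector space $T\mathfrak g=\mathfrak g\times\mathfrak g$ (base point, tangent component), hence a linear map $T\mathfrak g\to T\mathfrak g\wedge T\mathfrak g$. Identifications: $T\mathfrak g=\mathfrak g\times\mathfrak g$ is identified with the Lie algebra of $TG$ by $(X,Y)\mapsto\dot X+\widehat Y$, where $\dot X=T_ej_G(X)$ for the zero section $j_G:G\to TG$, and $\widehat Y=T_0j_{\mathfrak g}(Y)$ for the embedding $j_{\mathfrak g}:\mathfrak g=T_eG\hookrightarrow TG$. For a Lie algebra $\mathfrak h$, its tangent Lie algebra $T\mathfrak h$ is $\mathfrak h\times\mathfrak h$ with bracket $[(X,Y),(X',Y')]=([X,X'],[X,Y']+[Y,X'])$. The dual $(T\mathfrak g)^*$ is identified with $T(\mathfrak g^* )=\mathfrak g^*\times\mathfrak g^*$ by the tangent of the canonical pairing: $\langle(a,b),(X,Y)\rangle=\langle b,X\rangle+\langle a,Y\rangle$. *)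

theory Defs
  imports "HOL-Analysis.Analysis" "HOL-Algebra.Group"
begin

section \<open>Smooth maps between open sets\<close>

fun Ck_on :: "nat \<Rightarrow> 'a::real_normed_vector set \<Rightarrow> ('a \<Rightarrow> 'b::real_normed_vector) \<Rightarrow> bool" where
  "Ck_on 0 S f \<longleftrightarrow> continuous_on S f"
| "Ck_on (Suc k) S f \<longleftrightarrow>
     (\<forall>x\<in>S. f differentiable (at x)) \<and> (\<forall>v. Ck_on k S (\<lambda>x. frechet_derivative f (at x) v))"

text \<open>Meant for an open set \<open>S\<close> in a finite-dimensional space.\<close>

definition smooth_on :: "'a::real_normed_vector set \<Rightarrow> ('a \<Rightarrow> 'b::real_normed_vector) \<Rightarrow> bool" where
  "smooth_on S f \<longleftrightarrow> (\<forall>k. Ck_on k S f)"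

definition deriv_blinfun ::
    "('a::real_normed_vector \<Rightarrow> 'b::real_normed_vector) \<Rightarrow> 'a \<Rightarrow> 'a \<Rightarrow>\<^sub>L 'b" where
  "deriv_blinfun f x = Blinfun (frechet_derivative f (at x))"


section \<open>Smooth manifolds\<close>

text \<open>A chart is a pair of a domain and a coordinate map; only the values of the map on the
  domain matter.\<close>

type_synonym ('p, 'e) chart = "'p set \<times> ('p \<Rightarrow> 'e)"

definition chart_inv :: "('p, 'e) chart \<Rightarrow> 'e \<Rightarrow> 'p" where
  "chart_inv c = inv_into (fst c) (snd c)"

definition chart_image :: "('p, 'e) chart \<Rightarrow> 'e set" where
  "chart_image c = snd c ` fst c"

text \<open>The atlas need not be maximal. A preferred chart around each point is part of the data: the
  tangent space at \<open>p\<close> is represented by the model space \<open>'e\<close>, the vector \<open>v\<close> standing for the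
  tangent vector at \<open>p\<close> whose components in the chart \<open>chart_at M p\<close> are \<open>v\<close>. The choice of the
  preferred charts is arbitrary; another choice changes the tangent spaces by the canonical
  isomorphisms given by the derivatives of the transition maps.\<close>

record ('p, 'e) manifold =
  points :: "'p set"
  atlas :: "('p, 'e) chart set"
  chart_at :: "'p \<Rightarrow> ('p, 'e) chart"

definition manifold_topology :: "('p, 'e::euclidean_space) manifold \<Rightarrow> 'p topology" where
  "manifold_topology M =
     topology (\<lambda>U. U \<subseteq> points M \<and> (\<forall>c\<in>atlas M. open (snd c ` (U \<inter> fst c))))"

definition smooth_manifold :: "('p, 'e::euclidean_space) manifold \<Rightarrow> bool" where
  "smooth_manifold M \<longleftrightarrow>
     (\<forall>c\<in>atlas M. fst c \<subseteq> points M \<and> inj_on (snd c) (fst c) \<and> open (chart_image c)) \<and>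
     (\<forall>p\<in>points M. chart_at M p \<in> atlas M \<and> p \<in> fst (chart_at M p)) \<and>
     (\<forall>c\<in>atlas M. \<forall>d\<in>atlas M.
        open (snd c ` (fst c \<inter> fst d)) \<and>
        smooth_on (snd c ` (fst c \<inter> fst d)) (snd d \<circ> chart_inv c)) \<and>
     Hausdorff_space (manifold_topology M) \<and>
     second_countable (manifold_topology M)"

definition smooth_map ::
    "('p, 'e::euclidean_space) manifold \<Rightarrow> ('q, 'f::euclidean_space) manifold \<Rightarrow> ('p \<Rightarrow> 'q) \<Rightarrow> bool"
where
  "smooth_map M N f \<longleftrightarrow>
     f ` points M \<subseteq> points N \<and>
     (\<forall>c\<in>atlas M. \<forall>d\<in>atlas N.
        open (snd c ` (fst c \<inter> f -` fst d)) \<and>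
        smooth_on (snd c ` (fst c \<inter> f -` fst d)) (snd d \<circ> f \<circ> chart_inv c))"

text \<open>The tangent map of \<open>f\<close> at \<open>p\<close>, between the tangent spaces at \<open>p\<close> and at \<open>f p\<close>.\<close>

definition tangent_map_at ::
    "('p, 'e::euclidean_space) manifold \<Rightarrow> ('q, 'f::euclidean_space) manifold \<Rightarrow>
       ('p \<Rightarrow> 'q) \<Rightarrow> 'p \<Rightarrow> 'e \<Rightarrow>\<^sub>L 'f" where
  "tangent_map_at M N f p =
     deriv_blinfun (snd (chart_at N (f p)) \<circ> f \<circ> chart_inv (chart_at M p)) (snd (chart_at M p) p)"

text \<open>The derivative at \<open>p\<close> of a chart \<open>c\<close> around \<open>p\<close>: it sends a tangent vector at \<open>p\<close> to its
  components in \<open>c\<close>.\<close>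

definition components ::
    "('p, 'e::euclidean_space) manifold \<Rightarrow> ('p, 'e) chart \<Rightarrow> 'p \<Rightarrow> 'e \<Rightarrow>\<^sub>L 'e" where
  "components M c p = deriv_blinfun (snd c \<circ> chart_inv (chart_at M p)) (snd (chart_at M p) p)"

definition product_chart :: "('p, 'e) chart \<Rightarrow> ('q, 'f) chart \<Rightarrow> ('p \<times> 'q, 'e \<times> 'f) chart" where
  "product_chart c d = (fst c \<times> fst d, map_prod (snd c) (snd d))"

text \<open>The tangent space of the product at \<open>(p, q)\<close> is thus the product of the tangent spaces.\<close>

definition product_manifold ::
    "('p, 'e) manifold \<Rightarrow> ('q, 'f) manifold \<Rightarrow> ('p \<times> 'q, 'e \<times> 'f) manifold" where
  "product_manifold M N =
     \<lparr> points = points M \<times> points N,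
       atlas = {product_chart c d | c d. c \<in> atlas M \<and> d \<in> atlas N},
       chart_at = (\<lambda>(p, q). product_chart (chart_at M p) (chart_at N q)) \<rparr>"

text \<open>The tangent bundle with the induced coordinates \<open>(x, x')\<close>, where \<open>x'\<close> are the velocity coordinates.\<close>

definition tangent_chart ::
    "('p, 'e::euclidean_space) manifold \<Rightarrow> ('p, 'e) chart \<Rightarrow> ('p \<times> 'e, 'e \<times> 'e) chart" where
  "tangent_chart M c = (fst c \<times> UNIV, \<lambda>(p, v). (snd c p, components M c p v))"

definition tangent_bundle ::
    "('p, 'e::euclidean_space) manifold \<Rightarrow> ('p \<times> 'e, 'e \<times> 'e) manifold" where
  "tangent_bundle M =
     \<lparr> points = points M \<times> UNIV,
       atlas = tangent_chart M ` atlas M,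
       chart_at = (\<lambda>(p, v). tangent_chart M (chart_at M p)) \<rparr>"

text \<open>A vector space as a manifold, with one global chart; all its tangent spaces are the vector
  space itself, and its tangent bundle is the product of two copies of it (base point, tangent
  component).\<close>

definition vector_space_manifold :: "('e, 'e::euclidean_space) manifold" where
  "vector_space_manifold = \<lparr> points = UNIV, atlas = {(UNIV, id)}, chart_at = (\<lambda>_. (UNIV, id)) \<rparr>"


section \<open>Bivectors and bivector fields\<close>

type_synonym 'v dual = "'v \<Rightarrow>\<^sub>L real"

text \<open>The second exterior power of a finite-dimensional space \<open>'v\<close> is the space of alternating
  bilinear forms on the dual of \<open>'v\<close>, where \<open>u \<and> w\<close> is the form
  \<open>(\<xi>, \<eta>) \<mapsto> \<xi>(u) \<eta>(w) - \<xi>(w) \<eta>(u)\<close>.\<close>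

type_synonym 'v bivec = "'v dual \<Rightarrow> 'v dual \<Rightarrow> real"

definition bivector :: "'v::real_normed_vector bivec \<Rightarrow> bool" where
  "bivector \<beta> \<longleftrightarrow> bounded_bilinear \<beta> \<and> (\<forall>\<xi>. \<beta> \<xi> \<xi> = 0)"

definition wedge :: "'v::real_normed_vector \<Rightarrow> 'v \<Rightarrow> 'v bivec" where
  "wedge u w = (\<lambda>\<xi> \<eta>. \<xi> u * \<eta> w - \<xi> w * \<eta> u)"

text \<open>The second exterior power of a linear map.\<close>

definition wedge_map ::
    "('v::real_normed_vector \<Rightarrow>\<^sub>L 'w::real_normed_vector) \<Rightarrow> 'v bivec \<Rightarrow> 'w bivec" where
  "wedge_map A \<beta> = (\<lambda>\<xi> \<eta>. \<beta> (\<xi> o\<^sub>L A) (\<eta> o\<^sub>L A))"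

text \<open>The value at \<open>(p, q)\<close> of the direct sum of two bivector fields.\<close>

definition bivec_sum ::
    "'v::real_normed_vector bivec \<Rightarrow> 'w::real_normed_vector bivec \<Rightarrow> ('v \<times> 'w) bivec" where
  "bivec_sum \<beta> \<gamma> = (\<lambda>\<xi> \<eta>.
     wedge_map (Blinfun (\<lambda>v. (v, 0))) \<beta> \<xi> \<eta> + wedge_map (Blinfun (\<lambda>w. (0, w))) \<gamma> \<xi> \<eta>)"

definition bivec_in_chart ::
    "('p, 'e::euclidean_space) manifold \<Rightarrow> ('p \<Rightarrow> 'e bivec) \<Rightarrow> ('p, 'e) chart \<Rightarrow> 'e \<Rightarrow> 'e bivec" where
  "bivec_in_chart M \<Lambda> c x = wedge_map (components M c (chart_inv c x)) (\<Lambda> (chart_inv c x))"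

definition bivector_field :: "('p, 'e::euclidean_space) manifold \<Rightarrow> ('p \<Rightarrow> 'e bivec) \<Rightarrow> bool" where
  "bivector_field M \<Lambda> \<longleftrightarrow>
     (\<forall>p\<in>points M. bivector (\<Lambda> p)) \<and>
     (\<forall>c\<in>atlas M. \<forall>\<xi> \<eta>. smooth_on (chart_image c) (\<lambda>x. bivec_in_chart M \<Lambda> c x \<xi> \<eta>))"

text \<open>The coefficients \<open>\<Lambda>\<^sup>i\<^sup>j\<close> in \<open>\<Lambda> = 1/2 \<Lambda>\<^sup>i\<^sup>j \<partial>\<^sub>i \<and> \<partial>\<^sub>j\<close>. Coordinate indices are the elements of
  \<open>Basis\<close>, and \<open>blinfun_inner_left i\<close> is the covector \<open>dx\<^sup>i\<close>.\<close>

definition coeff ::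
    "('p, 'e::euclidean_space) manifold \<Rightarrow> ('p \<Rightarrow> 'e bivec) \<Rightarrow> ('p, 'e) chart \<Rightarrow> 'e \<Rightarrow> 'e \<Rightarrow> 'e \<Rightarrow> real"
where
  "coeff M \<Lambda> c i j x = bivec_in_chart M \<Lambda> c x (blinfun_inner_left i) (blinfun_inner_left j)"

definition dcoeff ::
    "('p, 'e::euclidean_space) manifold \<Rightarrow> ('p \<Rightarrow> 'e bivec) \<Rightarrow> ('p, 'e) chart \<Rightarrow>
       'e \<Rightarrow> 'e \<Rightarrow> 'e \<Rightarrow> 'e \<Rightarrow> real" where
  "dcoeff M \<Lambda> c k i j x = frechet_derivative (coeff M \<Lambda> c i j) (at x) k"

text \<open>The component with indices \<open>i, j, k\<close>, at the point with coordinates \<open>x\<close>, of the Schouten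
  bracket of two bivector fields (sign conventions differ by a global sign).\<close>

definition schouten ::
    "('p, 'e::euclidean_space) manifold \<Rightarrow> ('p \<Rightarrow> 'e bivec) \<Rightarrow> ('p \<Rightarrow> 'e bivec) \<Rightarrow>
       ('p, 'e) chart \<Rightarrow> 'e \<Rightarrow> 'e \<Rightarrow> 'e \<Rightarrow> 'e \<Rightarrow> real" where
  "schouten M \<Lambda> \<Theta> c i j k x = (\<Sum>l\<in>Basis.
       coeff M \<Lambda> c l i x * dcoeff M \<Theta> c l j k x + coeff M \<Theta> c l i x * dcoeff M \<Lambda> c l j k x
     + coeff M \<Lambda> c l j x * dcoeff M \<Theta> c l k i x + coeff M \<Theta> c l j x * dcoeff M \<Lambda> c l k i x
     + coeff M \<Lambda> c l k x * dcoeff M \<Theta> c l i j x + coeff M \<Theta> c l k x * dcoeff M \<Lambda> c l i j x)"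

definition poisson_structure :: "('p, 'e::euclidean_space) manifold \<Rightarrow> ('p \<Rightarrow> 'e bivec) \<Rightarrow> bool" where
  "poisson_structure M \<Lambda> \<longleftrightarrow>
     bivector_field M \<Lambda> \<and>
     (\<forall>c\<in>atlas M. \<forall>x\<in>chart_image c. \<forall>i\<in>Basis. \<forall>j\<in>Basis. \<forall>k\<in>Basis. schouten M \<Lambda> \<Lambda> c i j k x = 0)"

text \<open>The tangent lift at \<open>(p, v)\<close>, in the coordinates \<open>(x, x')\<close> induced by the preferred chart at
  \<open>p\<close>. These are the preferred coordinates of the tangent bundle at \<open>(p, v)\<close>, so \<open>(i, 0)\<close> is the
  vector \<open>\<partial>/\<partial>x\<^sup>i\<close>, \<open>(0, i)\<close> is the vector \<open>\<partial>/\<partial>x'\<^sup>i\<close>, and the coordinate \<open>x'\<^sup>k\<close> of \<open>(p, v)\<close> is \<open>v \<bullet> k\<close>.\<close>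

definition tangent_lift ::
    "('p, 'e::euclidean_space) manifold \<Rightarrow> ('p \<Rightarrow> 'e bivec) \<Rightarrow> 'p \<times> 'e \<Rightarrow> ('e \<times> 'e) bivec" where
  "tangent_lift M \<Lambda> = (\<lambda>(p, v) \<xi> \<eta>.
     let c = chart_at M p; x = snd c p in
       (\<Sum>i\<in>Basis. \<Sum>j\<in>Basis. coeff M \<Lambda> c i j x * wedge (i, 0) (0, j) \<xi> \<eta>)
     + 1/2 * (\<Sum>i\<in>Basis. \<Sum>j\<in>Basis.
         (\<Sum>k\<in>Basis. dcoeff M \<Lambda> c k i j x * (v \<bullet> k)) * wedge (0, i) (0, j) \<xi> \<eta>))"


section \<open>Poisson-Lie groups\<close>

definition lie_group :: "'p monoid \<Rightarrow> ('p, 'e::euclidean_space) manifold \<Rightarrow> bool" where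
  "lie_group G M \<longleftrightarrow>
     group G \<and> smooth_manifold M \<and> carrier G = points M \<and>
     smooth_map (product_manifold M M) M (\<lambda>(g, h). g \<otimes>\<^bsub>G\<^esub> h) \<and>
     smooth_map M M (\<lambda>g. inv\<^bsub>G\<^esub> g)"

definition poisson_lie_group ::
    "'p monoid \<Rightarrow> ('p, 'e::euclidean_space) manifold \<Rightarrow> ('p \<Rightarrow> 'e bivec) \<Rightarrow> bool" where
  "poisson_lie_group G M \<Lambda> \<longleftrightarrow>
     lie_group G M \<and> poisson_structure M \<Lambda> \<and>
     (\<forall>g\<in>carrier G. \<forall>h\<in>carrier G.
        wedge_map (tangent_map_at (product_manifold M M) M (\<lambda>(g, h). g \<otimes>\<^bsub>G\<^esub> h) (g, h))
          (bivec_sum (\<Lambda> g) (\<Lambda> h)) = \<Lambda> (g \<otimes>\<^bsub>G\<^esub> h))"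

text \<open>The bivector field trivialised by right translations, with values in the second exterior
  power of the Lie algebra, i.e. of the tangent space at \<open>\<one>\<close>, which is represented by \<open>'e\<close>.\<close>

definition right_trivialisation ::
    "'p monoid \<Rightarrow> ('p, 'e::euclidean_space) manifold \<Rightarrow> ('p \<Rightarrow> 'e bivec) \<Rightarrow> 'p \<Rightarrow> 'e bivec" where
  "right_trivialisation G M \<Lambda> g =
     wedge_map (tangent_map_at M M (\<lambda>h. h \<otimes>\<^bsub>G\<^esub> inv\<^bsub>G\<^esub> g) g) (\<Lambda> g)"

text \<open>\<open>\<delta>\<close> is the derivative of the right trivialisation at \<open>\<one>\<close>, as a map from the Lie algebra to its
  second exterior power. The derivative is taken in the preferred chart at \<open>\<one>\<close> and for each pair of
  arguments of the bivectors separately, which is the same as taking it in the finite-dimensional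
  space of bivectors.\<close>

definition is_cobracket ::
    "'p monoid \<Rightarrow> ('p, 'e::euclidean_space) manifold \<Rightarrow> ('p \<Rightarrow> 'e bivec) \<Rightarrow> ('e \<Rightarrow> 'e bivec) \<Rightarrow> bool"
where
  "is_cobracket G M \<Lambda> \<delta> \<longleftrightarrow>
     (\<forall>\<xi> \<eta>.
        ((\<lambda>x. right_trivialisation G M \<Lambda> (chart_inv (chart_at M \<one>\<^bsub>G\<^esub>) x) \<xi> \<eta>)
           has_derivative (\<lambda>X. \<delta> X \<xi> \<eta>)) (at (snd (chart_at M \<one>\<^bsub>G\<^esub>) \<one>\<^bsub>G\<^esub>)))"

text \<open>The dual \<open>\<delta>\<^sup>*\<close> of a linear map \<open>\<delta>\<close> from \<open>'v\<close> to its second exterior power.\<close>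

definition dual_bracket ::
    "('v::real_normed_vector \<Rightarrow> 'v bivec) \<Rightarrow> 'v dual \<Rightarrow> 'v dual \<Rightarrow> 'v dual" where
  "dual_bracket \<delta> \<xi> \<eta> = Blinfun (\<lambda>X. \<delta> X \<xi> \<eta>)"


section \<open>Tangent groups and tangent Lie algebras\<close>

text \<open>The tangent group: the multiplication is the tangent map of the multiplication of \<open>G\<close>, via
  the identification of pairs of tangent vectors with tangent vectors of the product.\<close>

definition tangent_group ::
    "'p monoid \<Rightarrow> ('p, 'e::euclidean_space) manifold \<Rightarrow> ('p \<times> 'e) monoid" where
  "tangent_group G M =
     \<lparr> carrier = points (tangent_bundle M),
       mult = (\<lambda>(g, v) (h, w).
         (g \<otimes>\<^bsub>G\<^esub> h,
          tangent_map_at (product_manifold M M) M (\<lambda>(g, h). g \<otimes>\<^bsub>G\<^esub> h) (g, h) (v, w))),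
       one = (\<one>\<^bsub>G\<^esub>, 0) \<rparr>"

text \<open>The identification of the tangent space of the Lie algebra of \<open>G\<close>, consisting of pairs
  \<open>(X, Y)\<close>, with the Lie algebra of the tangent group: \<open>X\<close> is mapped by the tangent map of the zero
  section of the tangent bundle, \<open>Y\<close> by the tangent map of the inclusion of the fibre at \<open>\<one>\<close>.\<close>

definition tangent_lie_algebra_iso ::
    "'p monoid \<Rightarrow> ('p, 'e::euclidean_space) manifold \<Rightarrow> 'e \<times> 'e \<Rightarrow> 'e \<times> 'e" where
  "tangent_lie_algebra_iso G M = (\<lambda>(X, Y).
     tangent_map_at M (tangent_bundle M) (\<lambda>g. (g, 0)) \<one>\<^bsub>G\<^esub> X
     + tangent_map_at vector_space_manifold (tangent_bundle M) (\<lambda>v. (\<one>\<^bsub>G\<^esub>, v)) 0 Y)"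

definition transport_cobracket ::
    "('v::real_normed_vector \<Rightarrow> 'w::real_normed_vector) \<Rightarrow> ('v \<Rightarrow> 'v bivec) \<Rightarrow> 'w \<Rightarrow> 'w bivec" where
  "transport_cobracket \<iota> \<delta> = (\<lambda>Z. wedge_map (Blinfun \<iota>) (\<delta> (inv_into UNIV \<iota> Z)))"

definition tangent_bracket :: "('h::real_vector \<Rightarrow> 'h \<Rightarrow> 'h) \<Rightarrow> 'h \<times> 'h \<Rightarrow> 'h \<times> 'h \<Rightarrow> 'h \<times> 'h" where
  "tangent_bracket br = (\<lambda>(a, b) (a', b'). (br a a', br a b' + br b a'))"

text \<open>The identification of the tangent space of the dual with the dual of the tangent space.\<close>

definition tangent_dual_iso :: "'v::real_normed_vector dual \<times> 'v dual \<Rightarrow> ('v \<times> 'v) dual" where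
  "tangent_dual_iso = (\<lambda>(a, b). Blinfun (\<lambda>(X, Y). b X + a Y))"

end

theory Submission
  imports Defs
begin

text \<open>Multiplicativity forces \<open>\<Lambda>\<close> to vanish at the unit. The right trivialisation is obtained from
  the coefficients of \<open>\<Lambda>\<close> in a chart by applying right translations, whose derivatives tend to the
  identity at the unit; since the coefficients vanish there, only their derivative contributes. So
  the cobracket is the derivative at the unit of the coefficients of \<open>\<Lambda>\<close> in the unit chart. The same
  argument applies to the tangent group, where the coefficients are those of \<open>d\<^sub>T\<Lambda>\<close> in the induced
  chart, and differentiating the coordinate formula of \<open>d\<^sub>T\<Lambda>\<close> at \<open>(x\<^sub>0, 0)\<close> gives the coordinate
  formula of the tangent lift of the linear field \<open>\<delta>\<close>. That the coordinate formula of \<open>d\<^sub>T\<Lambda>\<close> holds in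
  one chart around the unit, although \<open>d\<^sub>T\<Lambda>\<close> is defined pointwise by varying preferred charts, is its
  coordinate invariance, which rests on the symmetry of second derivatives.\<close>

section \<open>Second derivatives of smooth maps\<close>

text \<open>Tangent spaces are coordinatised by preferred charts that may jump from point to point,
  so a field on the bundle cannot be differentiated as it stands. Every derivative is therefore
  stated relative to an explicit pair of charts (\<open>chart_deriv\<close>), and passing to
  preferred charts is one more use of the chain rule. Smoothness is phrased through derivatives in
  fixed directions, whereas on a tangent bundle the direction v varies too; joint continuity and
  differentiability in (x, v) come from expanding v in \<open>Basis\<close>. The tangent lift is
  recast without indices as \<open>lift_in_chart\<close>: a covector on pairs splits into a base
  part b and a fibre part f, and the lift of K is K(b, f') + K(f, b') plus the derivative of K(f,
  f') along the velocity. One expression thus covers the lift of \<Lambda> in a chart and the lift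
  of the linear field \<delta>. The pairing of the dual is crossed, so (a, b) has fibre part a and
  base part b; with this, the three terms of the lift are those of the tangent Lie bracket.\<close>

lemma smooth_on_imp_differentiable:
  assumes "smooth_on S f" "x \<in> S"
  shows "f differentiable (at x)"
  using assms(1)[unfolded smooth_on_def, rule_format, of "Suc 0"] assms(2) by simp

lemma smooth_on_has_derivative:
  assumes "smooth_on S f" "x \<in> S"
  shows "(f has_derivative frechet_derivative f (at x)) (at x)"
  using smooth_on_imp_differentiable[OF assms] by (simp add: frechet_derivative_works)

lemma smooth_on_imp_continuous_on: "smooth_on S f \<Longrightarrow> continuous_on S f"
  using smooth_on_def Ck_on.simps(1) by blast

lemma smooth_on_frechet_derivative:
  assumes "smooth_on S f"
  shows "smooth_on S (\<lambda>x. frechet_derivative f (at x) v)"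
  unfolding smooth_on_def
proof
  fix k show "Ck_on k S (\<lambda>x. frechet_derivative f (at x) v)"
    using assms[unfolded smooth_on_def, rule_format, of "Suc k"] by simp
qed

text \<open>The mean value theorem is used twice: in r for the difference of \<open>f\<close> across
  the side v, then in s for the derivative along u. The second difference on the left is symmetric
  in u and v, and this is what makes it useful.\<close>

lemma second_difference_mean_value:
  fixes f :: "'a::real_normed_vector \<Rightarrow> real"
  assumes t: "0 < t" and "smooth_on S f"
    and S: "\<And>r s. 0 \<le> r \<Longrightarrow> r \<le> t \<Longrightarrow> 0 \<le> s \<Longrightarrow> s \<le> t \<Longrightarrow> x + r *\<^sub>R u + s *\<^sub>R v \<in> S"
  shows "\<exists>r s. 0 < r \<and> r < t \<and> 0 < s \<and> s < t \<and>
    f (x + t *\<^sub>R u + t *\<^sub>R v) - f (x + t *\<^sub>R u) - f (x + t *\<^sub>R v) + f x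
     = t * t * frechet_derivative (\<lambda>y. frechet_derivative f (at y) u) (at (x + r *\<^sub>R u + s *\<^sub>R v)) v"
proof -
  define D where "D y = frechet_derivative f (at y)" for y
  have D: "(f has_derivative D y) (at y)" if "y \<in> S" for y
    using smooth_on_has_derivative[OF assms(2) that] by (simp add: D_def)
  have D2: "((\<lambda>y. D y u) has_derivative frechet_derivative (\<lambda>y. D y u) (at y)) (at y)" if "y \<in> S" for y
    using smooth_on_has_derivative[OF smooth_on_frechet_derivative[OF assms(2)] that, of u] by (simp add: D_def)
  have "\<exists>r::real. r \<in> {0<..<t} \<and>
     (\<lambda>r. f (x + r *\<^sub>R u + t *\<^sub>R v) - f (x + r *\<^sub>R u + 0 *\<^sub>R v)) t - (\<lambda>r. f (x + r *\<^sub>R u + t *\<^sub>R v) - f (x + r *\<^sub>R u + 0 *\<^sub>R v)) 0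
      = (\<lambda>h. D (x + r *\<^sub>R u + t *\<^sub>R v) (h *\<^sub>R u) - D (x + r *\<^sub>R u + 0 *\<^sub>R v) (h *\<^sub>R u)) (t - 0)"
  proof (rule bexE[OF mvt_simple])
    show "0 < t" by (rule t)
  next
    fix r assume r: "0 \<le> r" "r \<le> t"
    have *: "((\<lambda>r. f (x + r *\<^sub>R u + c *\<^sub>R v)) has_derivative (\<lambda>h. D (x + r *\<^sub>R u + c *\<^sub>R v) (h *\<^sub>R u))) (at r)"
      if c: "0 \<le> c" "c \<le> t" for c
    proof -
      have "((\<lambda>r. x + r *\<^sub>R u + c *\<^sub>R v) has_derivative (\<lambda>h. h *\<^sub>R u)) (at r)"
        by (auto intro!: derivative_eq_intros)
      from has_derivative_compose[OF this D[OF S]] show ?thesis using c r by auto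
    qed
    show "((\<lambda>r. f (x + r *\<^sub>R u + t *\<^sub>R v) - f (x + r *\<^sub>R u + 0 *\<^sub>R v)) has_derivative
        (\<lambda>h. D (x + r *\<^sub>R u + t *\<^sub>R v) (h *\<^sub>R u) - D (x + r *\<^sub>R u + 0 *\<^sub>R v) (h *\<^sub>R u))) (at r within {0..t})"
      by (rule has_derivative_at_withinI, rule has_derivative_diff; rule *) (use t in auto)
  qed blast
  then obtain r where r: "0 < r" "r < t" and
    1: "f (x + t *\<^sub>R u + t *\<^sub>R v) - f (x + t *\<^sub>R u) - f (x + t *\<^sub>R v) + f x
      = D (x + r *\<^sub>R u + t *\<^sub>R v) (t *\<^sub>R u) - D (x + r *\<^sub>R u + 0 *\<^sub>R v) (t *\<^sub>R u)"
    by auto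
  have "\<exists>s::real. s \<in> {0<..<t} \<and>
     (\<lambda>s. D (x + r *\<^sub>R u + s *\<^sub>R v) u) t - (\<lambda>s. D (x + r *\<^sub>R u + s *\<^sub>R v) u) 0
      = (\<lambda>h. frechet_derivative (\<lambda>y. D y u) (at (x + r *\<^sub>R u + s *\<^sub>R v)) (h *\<^sub>R v)) (t - 0)"
  proof (rule bexE[OF mvt_simple])
    show "0 < t" by (rule t)
  next
    fix s assume s: "0 \<le> s" "s \<le> t"
    have "((\<lambda>s. x + r *\<^sub>R u + s *\<^sub>R v) has_derivative (\<lambda>h. h *\<^sub>R v)) (at s)"
      by (auto intro!: derivative_eq_intros)
    from has_derivative_compose[OF this D2[OF S]]
    show "((\<lambda>s. D (x + r *\<^sub>R u + s *\<^sub>R v) u) has_derivative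
        (\<lambda>h. frechet_derivative (\<lambda>y. D y u) (at (x + r *\<^sub>R u + s *\<^sub>R v)) (h *\<^sub>R v))) (at s within {0..t})"
      using s r by (auto intro: has_derivative_at_withinI)
  qed blast
  then obtain s where s: "0 < s" "s < t" and
    2: "D (x + r *\<^sub>R u + t *\<^sub>R v) u - D (x + r *\<^sub>R u + 0 *\<^sub>R v) u
      = frechet_derivative (\<lambda>y. D y u) (at (x + r *\<^sub>R u + s *\<^sub>R v)) (t *\<^sub>R v)"
    by auto
  have l1: "D (x + r *\<^sub>R u + c *\<^sub>R v) (t *\<^sub>R u) = t * D (x + r *\<^sub>R u + c *\<^sub>R v) u" if "0 \<le> c" "c \<le> t" for c
    using linear_scale[OF has_derivative_linear[OF D[OF S]]] r that by simp
  have l2: "frechet_derivative (\<lambda>y. D y u) (at (x + r *\<^sub>R u + s *\<^sub>R v)) (t *\<^sub>R v)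
     = t * frechet_derivative (\<lambda>y. D y u) (at (x + r *\<^sub>R u + s *\<^sub>R v)) v"
    using linear_scale[OF has_derivative_linear[OF D2[OF S]]] r s by simp
  show ?thesis
    using r s 1 2 l1[of t] l1[of 0] l2 t unfolding D_def
    by (intro exI[of _ r] exI[of _ s]) (simp add: algebra_simps)
qed

text \<open>Both mixed derivatives, taken at nearby points of a small parallelogram, equal the same
  second difference divided by t * t. Continuity of the second derivatives carries the equality to
  \<open>x\<close>.\<close>

lemma second_derivative_symmetric_real:
  fixes f :: "'a::real_normed_vector \<Rightarrow> real"
  assumes S: "open S" "x \<in> S" and f: "smooth_on S f"
  shows "frechet_derivative (\<lambda>y. frechet_derivative f (at y) u) (at x) v
       = frechet_derivative (\<lambda>y. frechet_derivative f (at y) v) (at x) u"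
proof -
  define H where "H u v y = frechet_derivative (\<lambda>y. frechet_derivative f (at y) u) (at y) v" for u v y
  have cont: "isCont (H u v) x" for u v
    using smooth_on_imp_continuous_on[OF smooth_on_frechet_derivative[OF smooth_on_frechet_derivative[OF f]]]
      S unfolding H_def by (simp add: continuous_on_eq_continuous_at)
  obtain e where e: "0 < e" "ball x e \<subseteq> S" using S open_contains_ball by blast
  have "dist (H u v x) (H v u x) < 2 * d" if d: "0 < d" for d
  proof -
    obtain d1 where d1: "0 < d1" "\<And>y. dist y x < d1 \<Longrightarrow> dist (H u v y) (H u v x) < d"
      using cont[of u v] d unfolding continuous_at_eps_delta by metis
    obtain d2 where d2: "0 < d2" "\<And>y. dist y x < d2 \<Longrightarrow> dist (H v u y) (H v u x) < d"
      using cont[of v u] d unfolding continuous_at_eps_delta by metis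
    \<comment> \<open>The parallelogram with sides t u and t v then stays within half the radius on
      which membership in \<open>S\<close> and both continuity estimates hold. The summand 1 keeps
      the denominator positive when u = v = 0.\<close>
    define t where "t = min e (min d1 d2) / (2 * (norm u + norm v + 1))"
    have N: "0 < norm u + norm v + 1" by (smt (verit) norm_ge_zero)
    have t: "0 < t" unfolding t_def using e d1 d2 N by simp
    have close: "dist (x + r *\<^sub>R u + s *\<^sub>R v) x < min e (min d1 d2)"
      if "0 \<le> r" "r \<le> t" "0 \<le> s" "s \<le> t" for r s
    proof -
      have "dist (x + r *\<^sub>R u + s *\<^sub>R v) x = norm (r *\<^sub>R u + s *\<^sub>R v)" by (simp add: dist_norm)
      also have "\<dots> \<le> r * norm u + s * norm v"
        using norm_triangle_ineq[of "r *\<^sub>R u" "s *\<^sub>R v"] that by simp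
      also have "\<dots> \<le> t * norm u + t * norm v"
        by (intro add_mono mult_right_mono) (use that in auto)
      also have "\<dots> \<le> t * (norm u + norm v + 1)" using t by (simp add: algebra_simps)
      also have "\<dots> = min e (min d1 d2) / 2" unfolding t_def using N by (simp add: field_simps del: min_less_iff_conj)
      also have "\<dots> < min e (min d1 d2)" using e d1 d2 by auto
      finally show ?thesis .
    qed
    have inS: "x + r *\<^sub>R u + s *\<^sub>R v \<in> S" if "0 \<le> r" "r \<le> t" "0 \<le> s" "s \<le> t" for r s
      using close[OF that] e by (auto simp: dist_commute subset_iff)
    then have inS': "x + r *\<^sub>R v + s *\<^sub>R u \<in> S" if "0 \<le> r" "r \<le> t" "0 \<le> s" "s \<le> t" for r s
      using that by (metis add.assoc add.commute)
    obtain r s where rs: "0 < r" "r < t" "0 < s" "s < t" and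
      1: "f (x + t *\<^sub>R u + t *\<^sub>R v) - f (x + t *\<^sub>R u) - f (x + t *\<^sub>R v) + f x
          = t * t * H u v (x + r *\<^sub>R u + s *\<^sub>R v)"
      using second_difference_mean_value[OF t f inS] unfolding H_def by blast
    obtain r' s' where rs': "0 < r'" "r' < t" "0 < s'" "s' < t" and
      2: "f (x + t *\<^sub>R v + t *\<^sub>R u) - f (x + t *\<^sub>R v) - f (x + t *\<^sub>R u) + f x
          = t * t * H v u (x + r' *\<^sub>R v + s' *\<^sub>R u)"
      using second_difference_mean_value[OF t f inS'] unfolding H_def by blast
    have "H u v (x + r *\<^sub>R u + s *\<^sub>R v) = H v u (x + s' *\<^sub>R u + r' *\<^sub>R v)"
      using 1 2 t by (simp add: algebra_simps)
    moreover have "dist (H u v (x + r *\<^sub>R u + s *\<^sub>R v)) (H u v x) < d"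
      by (rule d1(2)) (use close[of r s] rs in auto)
    moreover have "dist (H v u (x + s' *\<^sub>R u + r' *\<^sub>R v)) (H v u x) < d"
      by (rule d2(2)) (use close[of s' r'] rs' in auto)
    ultimately show ?thesis
      using dist_triangle3[of "H u v x" "H v u x" "H u v (x + r *\<^sub>R u + s *\<^sub>R v)"] by simp
  qed
  \<comment> \<open>With d half the distance, the estimate would say that the distance is smaller
    than itself, so the distance is 0.\<close>
  from this[of "dist (H u v x) (H v u x) / 2"] have "H u v x = H v u x" by force
  then show ?thesis by (simp add: H_def)
qed

text \<open>The argument \<open>v\<close> is the direction of the first differentiation, the
  remaining argument that of the second. Linearity in the last argument is immediate from this form;
  linearity in \<open>v\<close> is not.\<close>

definition second_derivative ::
    "('a::real_normed_vector \<Rightarrow> 'b::real_normed_vector) \<Rightarrow> 'a \<Rightarrow> 'a \<Rightarrow> 'a \<Rightarrow> 'b" where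
  "second_derivative f x v = frechet_derivative (\<lambda>y. frechet_derivative f (at y) v) (at x)"

section \<open>Second derivatives of vector-valued maps\<close>

lemma frechet_derivative_inner:
  assumes "f differentiable (at x)"
  shows "frechet_derivative (\<lambda>y. f y \<bullet> b) (at x) v = frechet_derivative f (at x) v \<bullet> b"
proof -
  have "((\<lambda>y. f y \<bullet> b) has_derivative (\<lambda>v. frechet_derivative f (at x) v \<bullet> b)) (at x)"
    using assms unfolding frechet_derivative_works by (auto intro!: derivative_eq_intros)
  from frechet_derivative_at[OF this] show ?thesis by (simp add: fun_eq_iff)
qed

lemma Ck_on_cong:
  assumes "open S" "\<And>x. x \<in> S \<Longrightarrow> p x = q x" "Ck_on n S p"
  shows "Ck_on n S q"
  using assms(2,3)
proof (induction n arbitrary: p q)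
  case 0
  then show ?case by (simp cong: continuous_on_cong)
next
  case (Suc n)
  have p: "(p has_derivative frechet_derivative p (at x)) (at x)" if "x \<in> S" for x
    using Suc.prems that by (simp add: frechet_derivative_works)
  have q: "(q has_derivative frechet_derivative p (at x)) (at x)" if "x \<in> S" for x
    by (rule has_derivative_transform_within_open[OF p assms(1)]) (use that Suc.prems in auto)
  have "Ck_on n S (\<lambda>x. frechet_derivative q (at x) v)" for v
  proof (rule Suc.IH)
    show "Ck_on n S (\<lambda>x. frechet_derivative p (at x) v)" using Suc.prems by simp
  qed (simp add: frechet_derivative_at[OF q])
  then show ?case using q by (auto simp: differentiable_def)
qed

lemma Ck_on_inner:
  assumes "open S" "Ck_on k S g"
  shows "Ck_on k S (\<lambda>y. g y \<bullet> b)"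
  using assms(2)
proof (induction k arbitrary: g)
  case 0
  then show ?case by (simp add: continuous_on_inner)
next
  case (Suc k)
  have g: "g differentiable (at x)" if "x \<in> S" for x
    using Suc.prems that by simp
  have "Ck_on k S (\<lambda>x. frechet_derivative (\<lambda>y. g y \<bullet> b) (at x) v)" for v
  proof (rule Ck_on_cong[OF assms(1)])
    show "Ck_on k S (\<lambda>x. frechet_derivative g (at x) v \<bullet> b)"
      using Suc.prems by (intro Suc.IH) simp
  qed (simp add: frechet_derivative_inner[OF g])
  moreover have "(\<lambda>y. g y \<bullet> b) differentiable (at x)" if "x \<in> S" for x
    using g[OF that] unfolding differentiable_def by (blast intro: has_derivative_inner_left)
  ultimately show ?case by simp
qed

lemma smooth_on_inner:
  assumes "open S" "smooth_on S f"
  shows "smooth_on S (\<lambda>y. f y \<bullet> b)"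
  using assms Ck_on_inner unfolding smooth_on_def by blast

text \<open>The mean value argument is one for real functions; inner products with vectors
  \<open>b\<close> reduce the general case to it.\<close>

lemma second_derivative_symmetric:
  fixes f :: "'a::real_normed_vector \<Rightarrow> 'b::euclidean_space"
  assumes S: "open S" "x \<in> S" and f: "smooth_on S f"
  shows "second_derivative f x u v = second_derivative f x v u"
proof (rule euclidean_eqI)
  fix b :: 'b
  have *: "second_derivative (\<lambda>y. f y \<bullet> b) x u v = second_derivative f x u v \<bullet> b" for u v
  proof -
    have "frechet_derivative (\<lambda>y. frechet_derivative (\<lambda>y. f y \<bullet> b) (at y) u) (at x)
        = frechet_derivative (\<lambda>y. frechet_derivative f (at y) u \<bullet> b) (at x)"
    proof (rule sym, rule frechet_derivative_transform_within_open[OF _ S])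
      show "(\<lambda>y. frechet_derivative f (at y) u \<bullet> b) differentiable (at x)"
        using smooth_on_imp_differentiable[OF smooth_on_inner[OF S(1) smooth_on_frechet_derivative[OF f]] S(2)] .
    qed (simp add: frechet_derivative_inner smooth_on_imp_differentiable[OF f])
    then show ?thesis unfolding second_derivative_def
      by (simp add: frechet_derivative_inner smooth_on_imp_differentiable[OF smooth_on_frechet_derivative[OF f] S(2)])
  qed
  show "second_derivative f x u v \<bullet> b = second_derivative f x v u \<bullet> b"
    using second_derivative_symmetric_real[OF S smooth_on_inner[OF S(1) f]]
    unfolding * [symmetric] by (simp add: second_derivative_def)
qed

lemma linear_second_derivative:
  assumes "smooth_on S f" "x \<in> S"
  shows "linear (second_derivative f x v)"
  unfolding second_derivative_def
  using has_derivative_linear[OF smooth_on_has_derivative[OF smooth_on_frechet_derivative[OF assms(1)] assms(2)]] .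

lemma frechet_derivative_basis_expansion:
  fixes f :: "'a::euclidean_space \<Rightarrow> 'b::real_normed_vector"
  assumes "f differentiable (at y)"
  shows "frechet_derivative f (at y) v = (\<Sum>b\<in>Basis. (v \<bullet> b) *\<^sub>R frechet_derivative f (at y) b)"
proof -
  have l: "linear (frechet_derivative f (at y))"
    by (rule linear_frechet_derivative[OF assms])
  have "frechet_derivative f (at y) v = frechet_derivative f (at y) (\<Sum>b\<in>Basis. (v \<bullet> b) *\<^sub>R b)"
    by (simp add: euclidean_representation)
  also have "\<dots> = (\<Sum>b\<in>Basis. (v \<bullet> b) *\<^sub>R frechet_derivative f (at y) b)"
    by (simp add: linear_sum[OF l] linear_scale[OF l])
  finally show ?thesis .
qed

text \<open>The first derivative is linear in its direction at every point of an open set, so its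
  expansion in \<open>Basis\<close> may be differentiated term by term.\<close>

lemma second_derivative_basis_expansion:
  fixes f :: "'a::euclidean_space \<Rightarrow> 'b::real_normed_vector"
  assumes S: "open S" "x \<in> S" and f: "smooth_on S f"
  shows "second_derivative f x v a = (\<Sum>b\<in>Basis. (v \<bullet> b) *\<^sub>R second_derivative f x b a)"
proof -
  have "((\<lambda>y. \<Sum>b\<in>Basis. (v \<bullet> b) *\<^sub>R frechet_derivative f (at y) b) has_derivative
      (\<lambda>a. \<Sum>b\<in>Basis. (v \<bullet> b) *\<^sub>R second_derivative f x b a)) (at x)"
    unfolding second_derivative_def
    by (intro has_derivative_sum has_derivative_scaleR_right
        smooth_on_has_derivative[OF smooth_on_frechet_derivative[OF f] S(2)])
  then have "((\<lambda>y. frechet_derivative f (at y) v) has_derivative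
      (\<lambda>a. \<Sum>b\<in>Basis. (v \<bullet> b) *\<^sub>R second_derivative f x b a)) (at x)"
    by (rule has_derivative_transform_within_open[OF _ S])
       (simp add: frechet_derivative_basis_expansion[OF smooth_on_imp_differentiable[OF f], symmetric])
  from frechet_derivative_at[OF this] show ?thesis
    unfolding second_derivative_def by (rule fun_cong[OF sym])
qed

lemma second_derivative_zero:
  fixes f :: "'a::euclidean_space \<Rightarrow> 'b::real_normed_vector"
  assumes S: "open S" "x \<in> S" and f: "smooth_on S f"
  shows "second_derivative f x 0 a = 0"
  by (subst second_derivative_basis_expansion[OF S f]) simp

text \<open>The coordinate form of the tangent map: velocities are carried along by the
  derivative.\<close>

definition tangent_fun :: "('a::real_normed_vector \<Rightarrow> 'b::real_normed_vector) \<Rightarrow> 'a \<times> 'a \<Rightarrow> 'b \<times> 'b" where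
  "tangent_fun f z = (f (fst z), frechet_derivative f (at (fst z)) (snd z))"

text \<open>Here base point and direction vary together. Expanding the direction in
  \<open>Basis\<close> leaves products of a linear coordinate with a derivative in a fixed
  direction, to which the product rule applies.\<close>

lemma frechet_derivative_has_derivative:
  fixes f :: "'a::euclidean_space \<Rightarrow> 'b::real_normed_vector"
  assumes S: "open S" "x \<in> S" and f: "smooth_on S f"
  shows "((\<lambda>z. frechet_derivative f (at (fst z)) (snd z)) has_derivative
     (\<lambda>w. second_derivative f x v (fst w) + frechet_derivative f (at x) (snd w))) (at (x, v))"
proof -
  have d: "((\<lambda>z. frechet_derivative f (at (fst z)) b) has_derivative
      (\<lambda>w. second_derivative f x b (fst w))) (at (x, v))" for b
    using has_derivative_compose[of fst fst "(x, v)" UNIV "\<lambda>y. frechet_derivative f (at y) b" "second_derivative f x b"]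
      smooth_on_has_derivative[OF smooth_on_frechet_derivative[OF f] S(2), of b]
    by (simp add: second_derivative_def has_derivative_fst)
  have "((\<lambda>z. \<Sum>b\<in>Basis. (snd z \<bullet> b) *\<^sub>R frechet_derivative f (at (fst z)) b) has_derivative
     (\<lambda>w. \<Sum>b\<in>Basis. (v \<bullet> b) *\<^sub>R second_derivative f x b (fst w) + (snd w \<bullet> b) *\<^sub>R frechet_derivative f (at x) b)) (at (x, v))"
    by (rule has_derivative_sum)
       (rule has_derivative_eq_rhs, rule has_derivative_scaleR[OF _ d], auto intro!: derivative_eq_intros)
  then have "((\<lambda>z. \<Sum>b\<in>Basis. (snd z \<bullet> b) *\<^sub>R frechet_derivative f (at (fst z)) b) has_derivative
     (\<lambda>w. second_derivative f x v (fst w) + frechet_derivative f (at x) (snd w))) (at (x, v))"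
    by (simp add: sum.distrib second_derivative_basis_expansion[OF S f, of v]
      frechet_derivative_basis_expansion[OF smooth_on_imp_differentiable[OF f S(2)], of "snd _"])
  then show ?thesis
  proof (rule has_derivative_transform_within_open)
    show "open (S \<times> (UNIV::'a set))" using S(1) by (simp add: open_Times)
  qed (use S(2) in \<open>auto simp: frechet_derivative_basis_expansion[OF smooth_on_imp_differentiable[OF f], symmetric]\<close>)
qed

lemma tangent_fun_has_derivative:
  fixes f :: "'a::euclidean_space \<Rightarrow> 'b::real_normed_vector"
  assumes S: "open S" "x \<in> S" and f: "smooth_on S f"
  shows "(tangent_fun f has_derivative (\<lambda>w. (frechet_derivative f (at x) (fst w),
     second_derivative f x v (fst w) + frechet_derivative f (at x) (snd w)))) (at (x, v))"
  unfolding tangent_fun_def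
  by (intro has_derivative_Pair frechet_derivative_has_derivative[OF S f]
     has_derivative_compose[of fst fst "(x, v)" UNIV f, simplified]
     has_derivative_fst has_derivative_ident)
     (use smooth_on_has_derivative[OF f S(2)] in simp)

section \<open>Derivatives in charts\<close>

text \<open>The conditions on a single chart, separated from any atlas, so that product charts and
  tangent charts can be used as charts in their own right.\<close>

definition coordinate_chart :: "('p, 'e::real_normed_vector) chart \<Rightarrow> bool" where
  "coordinate_chart c \<longleftrightarrow> inj_on (snd c) (fst c) \<and> open (chart_image c)"

lemma chart_inv_apply:
  "coordinate_chart c \<Longrightarrow> p \<in> fst c \<Longrightarrow> chart_inv c (snd c p) = p"
  by (simp add: chart_inv_def coordinate_chart_def)

lemma chart_inv_in: "x \<in> chart_image c \<Longrightarrow> chart_inv c x \<in> fst c"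
  unfolding chart_inv_def chart_image_def by (rule inv_into_into)

lemma chart_apply_inv: "x \<in> chart_image c \<Longrightarrow> snd c (chart_inv c x) = x"
  unfolding chart_inv_def chart_image_def by (rule f_inv_into_f)

lemma chart_image_apply: "p \<in> fst c \<Longrightarrow> snd c p \<in> chart_image c"
  by (simp add: chart_image_def)

lemma eventually_chart_image:
  assumes "coordinate_chart c" "p \<in> fst c"
  shows "\<forall>\<^sub>F x in nhds (snd c p). x \<in> chart_image c"
  using assms by (intro eventually_nhds_in_open) (auto simp: coordinate_chart_def chart_image_apply)

definition chart_expression ::
    "('p, 'e) chart \<Rightarrow> ('q, 'f) chart \<Rightarrow> ('p \<Rightarrow> 'q) \<Rightarrow> 'e \<Rightarrow> 'f" where
  "chart_expression c d f = (\<lambda>x. snd d (f (chart_inv c x)))"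

text \<open>The value of a chart map outside its domain is arbitrary. The clause that
  \<open>f\<close> maps a neighbourhood of \<open>p\<close> into the domain of \<open>d\<close>
  makes the coordinate expression meaningful near \<open>p\<close>, which the chain rule relies
  on.\<close>

definition chart_deriv ::
    "('p, 'e::real_normed_vector) chart \<Rightarrow> ('q, 'f::real_normed_vector) chart \<Rightarrow>
       ('p \<Rightarrow> 'q) \<Rightarrow> 'p \<Rightarrow> ('e \<Rightarrow> 'f) \<Rightarrow> bool" where
  "chart_deriv c d f p A \<longleftrightarrow>
     coordinate_chart c \<and> coordinate_chart d \<and> p \<in> fst c \<and> f p \<in> fst d \<and>
     (\<forall>\<^sub>F x in nhds (snd c p). f (chart_inv c x) \<in> fst d) \<and>
     (chart_expression c d f has_derivative A) (at (snd c p))"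

text \<open>The usual way in: a coordinate formula \<open>F\<close>, valid on an open set of
  coordinates, is differentiated in place of the chart expression.\<close>

lemma chart_derivI:
  assumes "coordinate_chart c" "coordinate_chart d" "p \<in> fst c" "open S" "snd c p \<in> S"
    and S: "\<And>q. q \<in> fst c \<Longrightarrow> snd c q \<in> S \<Longrightarrow> f q \<in> fst d \<and> snd d (f q) = F (snd c q)"
    and F: "(F has_derivative A) (at (snd c p))"
  shows "chart_deriv c d f p A"
  unfolding chart_deriv_def
proof (intro conjI assms(1-3))
  have T: "open (S \<inter> chart_image c)" "snd c p \<in> S \<inter> chart_image c"
    using assms by (auto simp: coordinate_chart_def chart_image_apply)
  have *: "f (chart_inv c x) \<in> fst d \<and> snd d (f (chart_inv c x)) = F x" if "x \<in> S \<inter> chart_image c" for x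
    using S[of "chart_inv c x"] that by (simp add: chart_inv_in chart_apply_inv)
  show "f p \<in> fst d" using S assms by blast
  show "\<forall>\<^sub>F x in nhds (snd c p). f (chart_inv c x) \<in> fst d"
    using eventually_nhds_in_open[OF T] by eventually_elim (use * in blast)
  show "(chart_expression c d f has_derivative A) (at (snd c p))"
    by (rule has_derivative_transform_within_open[OF F T]) (simp add: chart_expression_def *)
qed

lemma chart_deriv_bounded_linear: "chart_deriv c d f p A \<Longrightarrow> bounded_linear A"
  by (auto simp: chart_deriv_def intro: has_derivative_bounded_linear)

lemma chart_deriv_unique: "chart_deriv c d f p A \<Longrightarrow> chart_deriv c d f p B \<Longrightarrow> A = B"
  by (auto simp: chart_deriv_def intro: has_derivative_unique)

lemma chart_deriv_cong:
  assumes "chart_deriv c d f p A" "\<And>q. q \<in> fst c \<Longrightarrow> f q = g q"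
  shows "chart_deriv c d g p A"
proof -
  have c: "coordinate_chart c" "p \<in> fst c" using assms(1) by (auto simp: chart_deriv_def)
  have T: "open (chart_image c)" "snd c p \<in> chart_image c"
    using c by (auto simp: coordinate_chart_def chart_image_apply)
  have "\<forall>\<^sub>F x in nhds (snd c p). f (chart_inv c x) \<in> fst d" using assms(1) by (auto simp: chart_deriv_def)
  then have 1: "\<forall>\<^sub>F x in nhds (snd c p). g (chart_inv c x) \<in> fst d"
    using eventually_chart_image[OF c] by eventually_elim (use assms(2) chart_inv_in in metis)
  have "(chart_expression c d g has_derivative A) (at (snd c p))"
  proof (rule has_derivative_transform_within_open[OF _ T])
    show "(chart_expression c d f has_derivative A) (at (snd c p))"
      using assms(1) by (simp add: chart_deriv_def)
  qed (simp add: chart_expression_def assms(2) chart_inv_in)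
  then show ?thesis using assms 1 c by (auto simp: chart_deriv_def)
qed

lemma chart_deriv_compose:
  assumes f: "chart_deriv c d f p A" and g: "chart_deriv d e g (f p) B"
  shows "chart_deriv c e (\<lambda>x. g (f x)) p (\<lambda>v. B (A v))"
proof -
  have c: "coordinate_chart c" "p \<in> fst c" and d: "coordinate_chart d"
    using f g by (auto simp: chart_deriv_def)
  have df: "(chart_expression c d f has_derivative A) (at (snd c p))"
    and dg: "(chart_expression d e g has_derivative B) (at (snd d (f p)))"
    and evf: "\<forall>\<^sub>F x in nhds (snd c p). f (chart_inv c x) \<in> fst d"
    and evg: "\<forall>\<^sub>F x in nhds (snd d (f p)). g (chart_inv d x) \<in> fst e"
    using f g by (auto simp: chart_deriv_def)
  have eq: "chart_expression c d f (snd c p) = snd d (f p)"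
    using c by (simp add: chart_expression_def chart_inv_apply)
  \<comment> \<open>Differentiability gives continuity, which pulls the neighbourhood on which
    \<open>g\<close> lands in the domain of \<open>e\<close> back along \<open>f\<close>.\<close>
  have "filterlim (chart_expression c d f) (nhds (snd d (f p))) (nhds (snd c p))"
    using has_derivative_continuous[OF df] tendsto_at_iff_tendsto_nhds[of "chart_expression c d f" "snd c p"] eq
    by (simp add: isCont_def)
  then have "\<forall>\<^sub>F x in nhds (snd c p). g (chart_inv d (chart_expression c d f x)) \<in> fst e"
    using evg unfolding filterlim_iff by (elim allE impE)
  then have 1: "\<forall>\<^sub>F x in nhds (snd c p). g (f (chart_inv c x)) \<in> fst e"
    using evf by eventually_elim (simp add: chart_expression_def chart_inv_apply[OF d])
  have 2: "((\<lambda>x. chart_expression d e g (chart_expression c d f x)) has_derivative (\<lambda>v. B (A v))) (at (snd c p))"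
    by (rule has_derivative_compose[OF df]) (simp add: eq dg)
  obtain T where T: "open T" "snd c p \<in> T" "\<And>x. x \<in> T \<Longrightarrow> f (chart_inv c x) \<in> fst d"
    using evf unfolding eventually_nhds by blast
  have "(chart_expression c e (\<lambda>x. g (f x)) has_derivative (\<lambda>v. B (A v))) (at (snd c p))"
    by (rule has_derivative_transform_within_open[OF 2 T(1,2)])
       (simp add: chart_expression_def chart_inv_apply[OF d] T(3))
  then show ?thesis using f g 1 unfolding chart_deriv_def by blast
qed

lemma chart_deriv_const:
  assumes "coordinate_chart c" "p \<in> fst c" "coordinate_chart d" "q \<in> fst d"
  shows "chart_deriv c d (\<lambda>_. q) p (\<lambda>_. 0)"
  using assms by (auto simp: chart_deriv_def chart_expression_def)

lemma chart_deriv_ident: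
  assumes "coordinate_chart c" "p \<in> fst c"
  shows "chart_deriv c c (\<lambda>q. q) p (\<lambda>v. v)"
  by (rule chart_derivI[OF assms(1,1,2), of UNIV _ "\<lambda>x. x"]) auto

section \<open>Products of charts\<close>

lemma coordinate_chart_product:
  assumes "coordinate_chart c" "coordinate_chart d"
  shows "coordinate_chart (product_chart c d)"
  using assms unfolding coordinate_chart_def product_chart_def chart_image_def
  by (auto simp: map_prod_surj_on map_prod_inj_on open_Times)

lemma chart_inv_product:
  assumes "coordinate_chart c" "coordinate_chart d" "x \<in> chart_image c" "y \<in> chart_image d"
  shows "chart_inv (product_chart c d) (x, y) = (chart_inv c x, chart_inv d y)"
proof -
  have "chart_inv (product_chart c d) (snd (product_chart c d) (chart_inv c x, chart_inv d y)) = (chart_inv c x, chart_inv d y)"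
    by (rule chart_inv_apply[OF coordinate_chart_product[OF assms(1,2)]])
       (use assms in \<open>auto simp: product_chart_def chart_inv_in\<close>)
  then show ?thesis using assms by (simp add: product_chart_def chart_apply_inv)
qed

lemma chart_deriv_Pair:
  assumes f: "chart_deriv c d f p A" and g: "chart_deriv c e g p B"
  shows "chart_deriv c (product_chart d e) (\<lambda>x. (f x, g x)) p (\<lambda>v. (A v, B v))"
proof -
  have "\<forall>\<^sub>F x in nhds (snd c p). f (chart_inv c x) \<in> fst d" "\<forall>\<^sub>F x in nhds (snd c p). g (chart_inv c x) \<in> fst e"
    using f g by (auto simp: chart_deriv_def)
  then have ev: "\<forall>\<^sub>F x in nhds (snd c p). (f (chart_inv c x), g (chart_inv c x)) \<in> fst (product_chart d e)"
    by eventually_elim (simp add: product_chart_def)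
  have "chart_expression c (product_chart d e) (\<lambda>x. (f x, g x)) = (\<lambda>x. (chart_expression c d f x, chart_expression c e g x))"
    by (simp add: chart_expression_def product_chart_def)
  then show ?thesis
    using f g ev coordinate_chart_product[of d e] unfolding chart_deriv_def
    by (auto intro!: has_derivative_Pair simp: product_chart_def)
qed

lemma chart_deriv_map_prod:
  assumes f: "chart_deriv c d f p A" and g: "chart_deriv c' d' g q B"
  shows "chart_deriv (product_chart c c') (product_chart d d') (\<lambda>(x, y). (f x, g y)) (p, q) (\<lambda>(v, w). (A v, B w))"
proof -
  have cc: "coordinate_chart c" "coordinate_chart c'" "p \<in> fst c" "q \<in> fst c'"
    using f g by (auto simp: chart_deriv_def)
  have pc: "coordinate_chart (product_chart c c')" "(p, q) \<in> fst (product_chart c c')"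
    using coordinate_chart_product[of c c'] cc by (simp_all add: product_chart_def)
  have 1: "chart_deriv (product_chart c c') c fst (p, q) fst"
    by (rule chart_derivI[OF pc(1) cc(1) pc(2), of UNIV _ fst])
       (auto simp: product_chart_def intro: has_derivative_fst)
  have 2: "chart_deriv (product_chart c c') c' snd (p, q) snd"
    by (rule chart_derivI[OF pc(1) cc(2) pc(2), of UNIV _ snd])
       (auto simp: product_chart_def intro: has_derivative_snd)
  from chart_deriv_Pair[OF chart_deriv_compose[OF 1, of d f A] chart_deriv_compose[OF 2, of d' g B]] f g
  show ?thesis by (simp add: case_prod_unfold)
qed

section \<open>Charts of a manifold, transition maps and components\<close>

lemma smooth_manifold_coordinate_chart:
  "smooth_manifold M \<Longrightarrow> c \<in> atlas M \<Longrightarrow> coordinate_chart c"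
  by (auto simp: smooth_manifold_def coordinate_chart_def)

lemma smooth_manifold_chart_subset:
  "smooth_manifold M \<Longrightarrow> c \<in> atlas M \<Longrightarrow> p \<in> fst c \<Longrightarrow> p \<in> points M"
  by (auto simp: smooth_manifold_def)

lemma smooth_manifold_chart_at:
  "smooth_manifold M \<Longrightarrow> p \<in> points M \<Longrightarrow> chart_at M p \<in> atlas M"
  "smooth_manifold M \<Longrightarrow> p \<in> points M \<Longrightarrow> p \<in> fst (chart_at M p)"
  by (auto simp: smooth_manifold_def)

abbreviation transition :: "('p, 'e) chart \<Rightarrow> ('p, 'e) chart \<Rightarrow> 'e \<Rightarrow> 'e" where
  "transition c d \<equiv> chart_expression c d (\<lambda>q. q)"

lemma smooth_on_transition:
  assumes "smooth_manifold M" "c \<in> atlas M" "d \<in> atlas M"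
  shows "open (snd c ` (fst c \<inter> fst d))" "smooth_on (snd c ` (fst c \<inter> fst d)) (transition c d)"
  using assms by (auto simp: smooth_manifold_def chart_expression_def comp_def)

lemma smooth_on_chart_expression:
  assumes "smooth_map M N f" "c \<in> atlas M" "d \<in> atlas N"
  shows "open (snd c ` (fst c \<inter> f -` fst d))" "smooth_on (snd c ` (fst c \<inter> f -` fst d)) (chart_expression c d f)"
  using assms by (auto simp: smooth_map_def chart_expression_def comp_def)

lemma chart_deriv_smooth:
  assumes "coordinate_chart c" "coordinate_chart d" "p \<in> fst c" "f p \<in> fst d"
    and "open (snd c ` (fst c \<inter> f -` fst d))" "smooth_on (snd c ` (fst c \<inter> f -` fst d)) (chart_expression c d f)"
  shows "chart_deriv c d f p (frechet_derivative (chart_expression c d f) (at (snd c p)))"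
proof (rule chart_derivI[OF assms(1-3,5)])
  show p: "snd c p \<in> snd c ` (fst c \<inter> f -` fst d)" using assms by blast
  show "f q \<in> fst d \<and> snd d (f q) = chart_expression c d f (snd c q)"
    if "q \<in> fst c" "snd c q \<in> snd c ` (fst c \<inter> f -` fst d)" for q
    using that assms(1) by (auto simp: chart_expression_def chart_inv_apply coordinate_chart_def dest: inj_onD)
  show "(chart_expression c d f has_derivative frechet_derivative (chart_expression c d f) (at (snd c p))) (at (snd c p))"
    by (rule smooth_on_has_derivative[OF assms(6) p])
qed

lemma chart_deriv_transition:
  assumes "smooth_manifold M" "c \<in> atlas M" "d \<in> atlas M" "p \<in> fst c" "p \<in> fst d"
  shows "chart_deriv c d (\<lambda>q. q) p (frechet_derivative (transition c d) (at (snd c p)))"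
  using assms smooth_on_transition[OF assms(1-3)]
  by (intro chart_deriv_smooth) (auto simp: smooth_manifold_coordinate_chart)

lemma components_eqI:
  assumes "chart_deriv (chart_at M p) c (\<lambda>q. q) p A"
  shows "blinfun_apply (components M c p) = A"
proof -
  have "(snd c \<circ> chart_inv (chart_at M p) has_derivative A) (at (snd (chart_at M p) p))"
    using assms by (simp add: chart_deriv_def chart_expression_def comp_def)
  from frechet_derivative_at[OF this] show ?thesis
    using chart_deriv_bounded_linear[OF assms]
    by (simp add: components_def deriv_blinfun_def bounded_linear_Blinfun_apply)
qed

lemma tangent_map_at_eqI:
  assumes "chart_deriv (chart_at M p) (chart_at N (f p)) f p A"
  shows "blinfun_apply (tangent_map_at M N f p) = A"
proof -
  have "(snd (chart_at N (f p)) \<circ> f \<circ> chart_inv (chart_at M p) has_derivative A) (at (snd (chart_at M p) p))"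
    using assms by (simp add: chart_deriv_def chart_expression_def comp_def)
  from frechet_derivative_at[OF this] show ?thesis
    using chart_deriv_bounded_linear[OF assms]
    by (simp add: tangent_map_at_def deriv_blinfun_def bounded_linear_Blinfun_apply)
qed

lemma chart_deriv_components:
  assumes "smooth_manifold M" "c \<in> atlas M" "p \<in> fst c"
  shows "chart_deriv (chart_at M p) c (\<lambda>q. q) p (blinfun_apply (components M c p))"
proof -
  have "chart_deriv (chart_at M p) c (\<lambda>q. q) p (frechet_derivative (transition (chart_at M p) c) (at (snd (chart_at M p) p)))"
    using assms smooth_manifold_chart_at[of M p] smooth_manifold_chart_subset[OF assms]
    by (intro chart_deriv_transition) auto
  from this components_eqI[OF this] show ?thesis by simp
qed

lemma components_chart_at:
  assumes "smooth_manifold M" "p \<in> points M"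
  shows "components M (chart_at M p) p = id_blinfun"
proof (rule blinfun_eqI)
  have "chart_deriv (chart_at M p) (chart_at M p) (\<lambda>q. q) p (\<lambda>v. v)"
    using assms by (intro chart_deriv_ident) (auto simp: smooth_manifold_chart_at smooth_manifold_coordinate_chart)
  then show "blinfun_apply (components M (chart_at M p) p) v = blinfun_apply id_blinfun v" for v
    by (simp add: components_eqI)
qed

lemma components_transition:
  assumes "smooth_manifold M" "c \<in> atlas M" "d \<in> atlas M" "p \<in> fst c" "p \<in> fst d"
  shows "components M d p v = frechet_derivative (transition c d) (at (snd c p)) (components M c p v)"
  using components_eqI[OF chart_deriv_compose[OF chart_deriv_components[OF assms(1,2,4)] chart_deriv_transition[OF assms]]]
  by simp

text \<open>The transition to \<open>c\<close> and the one back compose to the identity in both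
  orders, so by the chain rule their derivatives are mutually inverse. This makes tangent charts
  injective and gives their image every velocity.\<close>

lemma bij_components:
  assumes "smooth_manifold M" "c \<in> atlas M" "p \<in> fst c"
  shows "bij (blinfun_apply (components M c p))"
proof -
  have p: "p \<in> points M" using smooth_manifold_chart_subset[OF assms] .
  note a = smooth_manifold_chart_at[OF assms(1) p]
  define B where "B = frechet_derivative (transition c (chart_at M p)) (at (snd c p))"
  have B: "chart_deriv c (chart_at M p) (\<lambda>q. q) p B"
    unfolding B_def by (rule chart_deriv_transition[OF assms(1,2) a(1) assms(3) a(2)])
  have 1: "(\<lambda>v. B (components M c p v)) = (\<lambda>v. v)"
    by (rule chart_deriv_unique[OF chart_deriv_compose[OF chart_deriv_components[OF assms] B] chart_deriv_ident])
       (use a assms in \<open>auto intro: smooth_manifold_coordinate_chart\<close>)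
  have 2: "(\<lambda>v. components M c p (B v)) = (\<lambda>v. v)"
    by (rule chart_deriv_unique[OF chart_deriv_compose[OF B chart_deriv_components[OF assms]] chart_deriv_ident])
       (use a assms in \<open>auto intro: smooth_manifold_coordinate_chart\<close>)
  show ?thesis by (rule o_bij[of B]) (use 1 2 in \<open>auto simp: fun_eq_iff\<close>)
qed

section \<open>Charts of the tangent bundle\<close>

lemma coordinate_chart_tangent:
  assumes "smooth_manifold M" "c \<in> atlas M"
  shows "coordinate_chart (tangent_chart M c)"
    and "chart_image (tangent_chart M c) = chart_image c \<times> UNIV"
proof -
  note c = smooth_manifold_coordinate_chart[OF assms]
  show im: "chart_image (tangent_chart M c) = chart_image c \<times> UNIV"
  proof safe
    fix x v assume "x \<in> chart_image c"
    then obtain p where p: "p \<in> fst c" "x = snd c p" by (auto simp: chart_image_def)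
    obtain u where "v = components M c p u"
      using bij_components[OF assms p(1)] by (metis bij_pointE)
    then show "(x, v) \<in> chart_image (tangent_chart M c)"
      using p unfolding chart_image_def tangent_chart_def
      by (intro image_eqI[of _ _ "(p, u)"]) auto
  qed (auto simp: chart_image_def tangent_chart_def)
  have "inj_on (snd (tangent_chart M c)) (fst (tangent_chart M c))"
  proof (rule inj_onI, safe)
    fix p u q w
    assume "(p, u) \<in> fst (tangent_chart M c)" "(q, w) \<in> fst (tangent_chart M c)"
      and eq: "snd (tangent_chart M c) (p, u) = snd (tangent_chart M c) (q, w)"
    then have pq: "p \<in> fst c" "q \<in> fst c" by (auto simp: tangent_chart_def)
    with eq c show "p = q" by (auto simp: tangent_chart_def coordinate_chart_def dest: inj_onD)
    with eq show "u = w"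
      using bij_components[OF assms pq(1)] by (auto simp: tangent_chart_def bij_def dest: injD)
  qed
  with c im show "coordinate_chart (tangent_chart M c)"
    by (auto simp: coordinate_chart_def open_Times)
qed

text \<open>Induced coordinates change by the tangent map of the transition, whose derivative is
  block triangular. The off-diagonal block, a second derivative, is the term that any proof of
  invariance of the tangent lift has to absorb.\<close>

lemma chart_deriv_tangent_transition:
  fixes M :: "('p, 'e::euclidean_space) manifold"
  assumes M: "smooth_manifold M" and cd: "c \<in> atlas M" "d \<in> atlas M" "p \<in> fst c" "p \<in> fst d"
  defines "\<phi> \<equiv> transition c d"
  shows "chart_deriv (tangent_chart M c) (tangent_chart M d) (\<lambda>z. z) (p, u)
    (\<lambda>w. (frechet_derivative \<phi> (at (snd c p)) (fst w),
       second_derivative \<phi> (snd c p) (components M c p u) (fst w)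
        + frechet_derivative \<phi> (at (snd c p)) (snd w)))"
proof (rule chart_derivI[where F = "tangent_fun \<phi>"])
  define S where "S = snd c ` (fst c \<inter> fst d)"
  have S: "open S" "smooth_on S \<phi>" "snd c p \<in> S"
    using smooth_on_transition[OF M cd(1,2)] cd by (auto simp: S_def \<phi>_def)
  show "open (S \<times> (UNIV::'e set))" using S by (simp add: open_Times)
  show "snd (tangent_chart M c) (p, u) \<in> S \<times> (UNIV::'e set)" using S by (simp add: tangent_chart_def)
  show "(tangent_fun \<phi> has_derivative (\<lambda>w. (frechet_derivative \<phi> (at (snd c p)) (fst w),
       second_derivative \<phi> (snd c p) (components M c p u) (fst w)
        + frechet_derivative \<phi> (at (snd c p)) (snd w)))) (at (snd (tangent_chart M c) (p, u)))"
    using tangent_fun_has_derivative[OF S(1,3,2)] by (simp add: tangent_chart_def)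
  fix z assume z: "z \<in> fst (tangent_chart M c)" "snd (tangent_chart M c) z \<in> S \<times> (UNIV::'e set)"
  obtain q w where qw: "z = (q, w)" by fastforce
  note c = smooth_manifold_coordinate_chart[OF M cd(1)]
  have q: "q \<in> fst c" "q \<in> fst d"
    using z c by (auto simp: qw tangent_chart_def S_def coordinate_chart_def dest: inj_onD)
  show "z \<in> fst (tangent_chart M d) \<and> snd (tangent_chart M d) z = tangent_fun \<phi> (snd (tangent_chart M c) z)"
    using q components_transition[OF M cd(1,2) q]
    by (simp add: qw tangent_chart_def tangent_fun_def \<phi>_def chart_expression_def chart_inv_apply[OF c])
qed (use cd coordinate_chart_tangent(1)[OF M] in \<open>simp_all add: tangent_chart_def\<close>)

lemma chart_deriv_smooth_map:
  assumes "smooth_manifold M" "smooth_manifold N" "smooth_map M N f" "c \<in> atlas M" "d \<in> atlas N"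
    "p \<in> fst c" "f p \<in> fst d"
  shows "chart_deriv c d f p (frechet_derivative (chart_expression c d f) (at (snd c p)))"
  using assms smooth_on_chart_expression[OF assms(3-5)]
  by (intro chart_deriv_smooth) (auto simp: smooth_manifold_coordinate_chart)

text \<open>Tangent maps are defined in preferred charts, while computations use charts
  \<open>c\<close> and \<open>d\<close> of choice. This lemma translates: \<open>A\<close> is the
  derivative in the chosen charts and \<open>B\<close> changes the source chart.\<close>

lemma components_tangent_map_at:
  assumes N: "smooth_manifold N" and f: "chart_deriv c d f p A" "chart_deriv (chart_at M p) c (\<lambda>q. q) p B"
    and d: "d \<in> atlas N" "f p \<in> fst d"
  shows "components N d (f p) (tangent_map_at M N f p v) = A (B v)"
    "chart_deriv (chart_at M p) (chart_at N (f p)) f p (blinfun_apply (tangent_map_at M N f p))"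
proof -
  have fp: "f p \<in> points N" using smooth_manifold_chart_subset[OF N d] .
  note a = smooth_manifold_chart_at[OF N fp]
  have dp: "chart_deriv (chart_at M p) d f p (\<lambda>v. A (B v))"
    using chart_deriv_compose[OF f(2,1)] .
  have "chart_deriv (chart_at M p) (chart_at N (f p)) f p
      (\<lambda>v. frechet_derivative (transition d (chart_at N (f p))) (at (snd d (f p))) (A (B v)))"
    using chart_deriv_compose[OF dp chart_deriv_transition[OF N d(1) a(1) d(2) a(2)]] .
  from this tangent_map_at_eqI[OF this]
  show t: "chart_deriv (chart_at M p) (chart_at N (f p)) f p (blinfun_apply (tangent_map_at M N f p))"
    by simp
  have "chart_deriv (chart_at M p) d f p (\<lambda>v. components N d (f p) (tangent_map_at M N f p v))"
    using chart_deriv_compose[OF t chart_deriv_components[OF N d]] .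
  from fun_cong[OF chart_deriv_unique[OF this dp]]
  show "components N d (f p) (tangent_map_at M N f p v) = A (B v)" .
qed

section \<open>Bivectors and the tangent lift in charts\<close>

lemma dual_basis_expansion:
  fixes \<xi> :: "'v::euclidean_space dual"
  shows "\<xi> = (\<Sum>i\<in>Basis. \<xi> i *\<^sub>R blinfun_inner_left i)"
proof (rule blinfun_eqI)
  fix v
  have "\<xi> v = \<xi> (\<Sum>i\<in>Basis. (v \<bullet> i) *\<^sub>R i)" by (simp add: euclidean_representation)
  also have "\<dots> = (\<Sum>i\<in>Basis. \<xi> i *\<^sub>R blinfun_inner_left i) v"
    by (simp add: blinfun.sum_right blinfun.scaleR_right blinfun.sum_left blinfun.scaleR_left mult.commute inner_commute)
  finally show "\<xi> v = (\<Sum>i\<in>Basis. \<xi> i *\<^sub>R blinfun_inner_left i) v" .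
qed

lemma bivector_antisym: "bivector \<beta> \<Longrightarrow> \<beta> \<xi> \<eta> = - \<beta> \<eta> \<xi>"
proof -
  assume b: "bivector \<beta>"
  interpret bounded_bilinear \<beta> using b by (simp add: bivector_def)
  have "\<beta> (\<xi> + \<eta>) (\<xi> + \<eta>) = 0" "\<beta> \<xi> \<xi> = 0" "\<beta> \<eta> \<eta> = 0" using b by (auto simp: bivector_def)
  then show ?thesis by (simp add: add_left add_right)
qed

lemma bivector_basis_expansion:
  fixes \<beta> :: "'v::euclidean_space bivec"
  assumes "bivector \<beta>"
  shows "\<beta> \<xi> \<eta> = (\<Sum>i\<in>Basis. \<Sum>j\<in>Basis. \<beta> (blinfun_inner_left i) (blinfun_inner_left j) * (\<xi> i * \<eta> j))"
proof -
  interpret bounded_bilinear \<beta> using assms by (simp add: bivector_def)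
  have "\<beta> \<xi> \<eta> = \<beta> (\<Sum>i\<in>Basis. \<xi> i *\<^sub>R blinfun_inner_left i) (\<Sum>j\<in>Basis. \<eta> j *\<^sub>R blinfun_inner_left j)"
    using dual_basis_expansion[of \<xi>] dual_basis_expansion[of \<eta>] by simp
  also have "\<dots> = (\<Sum>i\<in>Basis. \<Sum>j\<in>Basis. \<beta> (blinfun_inner_left i) (blinfun_inner_left j) * (\<xi> i * \<eta> j))"
    unfolding sum_left sum_right scaleR_left scaleR_right
    by (subst sum.swap) (simp add: sum_distrib_left sum_distrib_right mult_ac)
  finally show ?thesis .
qed

lemma bounded_bilinear_add:
  assumes "bounded_bilinear f" "bounded_bilinear g"
  shows "bounded_bilinear (\<lambda>x y. f x y + g x y)"
proof -
  interpret f: bounded_bilinear f by fact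
  interpret g: bounded_bilinear g by fact
  show ?thesis
  proof
    obtain A where A: "\<And>x y. norm (f x y) \<le> norm x * norm y * A" using f.bounded by blast
    obtain B where B: "\<And>x y. norm (g x y) \<le> norm x * norm y * B" using g.bounded by blast
    have "norm (f x y + g x y) \<le> norm x * norm y * (A + B)" for x y
      unfolding distrib_left by (rule norm_triangle_le) (rule add_mono[OF A B])
    then show "\<exists>K. \<forall>x y. norm (f x y + g x y) \<le> norm x * norm y * K" by blast
  qed (simp_all add: f.add_left f.add_right f.scaleR_left f.scaleR_right
      g.add_left g.add_right g.scaleR_left g.scaleR_right scaleR_add_right)
qed

lemma bivector_wedge_map:
  assumes "bivector \<beta>"
  shows "bivector (wedge_map A \<beta>)"
proof -
  interpret bounded_bilinear \<beta> using assms by (simp add: bivector_def)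
  have "bounded_linear (\<lambda>\<xi>. \<xi> o\<^sub>L A)"
    by (rule bounded_bilinear.bounded_linear_left[OF bounded_bilinear_blinfun_compose])
  from comp[OF this this] assms show ?thesis by (simp add: bivector_def wedge_map_def)
qed

lemma blinfun_compose_assoc: "(f o\<^sub>L g) o\<^sub>L h = f o\<^sub>L (g o\<^sub>L h)"
  by (rule blinfun_eqI) simp

lemma wedge_map_compose: "wedge_map A (wedge_map B \<beta>) = wedge_map (A o\<^sub>L B) \<beta>"
  by (simp add: wedge_map_def blinfun_compose_assoc)

lemma wedge_map_id: "wedge_map id_blinfun \<beta> = \<beta>"
proof -
  have "\<xi> o\<^sub>L id_blinfun = \<xi>" for \<xi> :: "'a dual" by (rule blinfun_eqI) simp
  then show ?thesis by (simp add: wedge_map_def)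
qed

lemma bivec_in_chart_apply:
  "coordinate_chart c \<Longrightarrow> p \<in> fst c \<Longrightarrow> bivec_in_chart M \<Lambda> c (snd c p) = wedge_map (components M c p) (\<Lambda> p)"
  by (simp add: bivec_in_chart_def chart_inv_apply)

lemma bivector_bivec_in_chart:
  assumes "smooth_manifold M" "bivector_field M \<Lambda>" "c \<in> atlas M" "x \<in> chart_image c"
  shows "bivector (bivec_in_chart M \<Lambda> c x)"
  using assms smooth_manifold_chart_subset[OF assms(1,3) chart_inv_in[OF assms(4)]]
  unfolding bivec_in_chart_def by (intro bivector_wedge_map) (simp add: bivector_field_def)

lemma smooth_on_bivec_in_chart:
  "bivector_field M \<Lambda> \<Longrightarrow> c \<in> atlas M \<Longrightarrow> smooth_on (chart_image c) (\<lambda>x. bivec_in_chart M \<Lambda> c x \<xi> \<eta>)"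
  by (simp add: bivector_field_def)

text \<open>Families of bivectors are differentiated argument by argument; expansion in coefficients
  shows that the result is again given by finitely many scalar derivatives, hence again bilinear in
  the covectors.\<close>

lemma bivector_family_frechet_derivative_expansion:
  fixes K :: "'a::real_normed_vector \<Rightarrow> 'v::euclidean_space bivec"
  assumes S: "open S" "x \<in> S" and K: "\<And>y. y \<in> S \<Longrightarrow> bivector (K y)"
    and dK: "\<And>\<xi> \<eta>. (\<lambda>y. K y \<xi> \<eta>) differentiable (at x)"
  shows "frechet_derivative (\<lambda>y. K y \<xi> \<eta>) (at x) h = (\<Sum>i\<in>Basis. \<Sum>j\<in>Basis.
     frechet_derivative (\<lambda>y. K y (blinfun_inner_left i) (blinfun_inner_left j)) (at x) h * (\<xi> i * \<eta> j))"
proof -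
  have "((\<lambda>y. \<Sum>i\<in>Basis. \<Sum>j\<in>Basis. K y (blinfun_inner_left i) (blinfun_inner_left j) * (\<xi> i * \<eta> j)) has_derivative
    (\<lambda>h. \<Sum>i\<in>Basis. \<Sum>j\<in>Basis. frechet_derivative (\<lambda>y. K y (blinfun_inner_left i) (blinfun_inner_left j)) (at x) h * (\<xi> i * \<eta> j))) (at x)"
    by (intro has_derivative_sum has_derivative_mult_left dK[unfolded frechet_derivative_works])
  then have "((\<lambda>y. K y \<xi> \<eta>) has_derivative
    (\<lambda>h. \<Sum>i\<in>Basis. \<Sum>j\<in>Basis. frechet_derivative (\<lambda>y. K y (blinfun_inner_left i) (blinfun_inner_left j)) (at x) h * (\<xi> i * \<eta> j))) (at x)"
    by (rule has_derivative_transform_within_open[OF _ S])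
       (simp add: bivector_basis_expansion[OF K, symmetric])
  from fun_cong[OF frechet_derivative_at[OF this, symmetric]] show ?thesis .
qed

lemma bounded_bilinear_dual_form:
  fixes d :: "'v::euclidean_space \<Rightarrow> 'v \<Rightarrow> real"
  shows "bounded_bilinear (\<lambda>(\<xi>::'v dual) (\<eta>::'v dual). \<Sum>i\<in>Basis. \<Sum>j\<in>Basis. d i j * (blinfun_apply \<xi> i * blinfun_apply \<eta> j))"
proof
  show "\<exists>C. \<forall>(\<xi>::'v dual) (\<eta>::'v dual). norm (\<Sum>i\<in>Basis. \<Sum>j\<in>Basis. d i j * (blinfun_apply \<xi> i * blinfun_apply \<eta> j)) \<le> norm \<xi> * norm \<eta> * C"
  proof (intro exI allI)
    fix \<xi> \<eta> :: "'v dual"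
    have n: "\<bar>blinfun_apply \<zeta> i\<bar> \<le> norm \<zeta>" if "i \<in> Basis" for \<zeta> :: "'v dual" and i
      using norm_blinfun[of \<zeta> i] that by simp
    have "norm (\<Sum>i\<in>Basis. \<Sum>j\<in>Basis. d i j * (blinfun_apply \<xi> i * blinfun_apply \<eta> j)) \<le> (\<Sum>i\<in>Basis. \<Sum>j\<in>Basis. \<bar>d i j\<bar> * (norm \<xi> * norm \<eta>))"
      by (intro sum_norm_le) (auto simp: abs_mult intro!: mult_mono n)
    then show "norm (\<Sum>i\<in>Basis. \<Sum>j\<in>Basis. d i j * (blinfun_apply \<xi> i * blinfun_apply \<eta> j)) \<le> norm \<xi> * norm \<eta> * (\<Sum>i\<in>Basis. \<Sum>j\<in>Basis. \<bar>d i j\<bar>)"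
      by (simp add: sum_distrib_left mult_ac)
  qed
qed (simp_all add: blinfun.add_left blinfun.scaleR_left sum.distrib sum_distrib_left algebra_simps)

lemma bivector_frechet_derivative:
  fixes K :: "'a::real_normed_vector \<Rightarrow> 'v::euclidean_space bivec"
  assumes S: "open S" "x \<in> S" and K: "\<And>y. y \<in> S \<Longrightarrow> bivector (K y)"
    and dK: "\<And>\<xi> \<eta>. (\<lambda>y. K y \<xi> \<eta>) differentiable (at x)"
  shows "bivector (\<lambda>\<xi> \<eta>. frechet_derivative (\<lambda>y. K y \<xi> \<eta>) (at x) h)"
  unfolding bivector_def
proof
  show "bounded_bilinear (\<lambda>\<xi> \<eta>. frechet_derivative (\<lambda>y. K y \<xi> \<eta>) (at x) h)"
  proof -
    have "(\<lambda>\<xi> \<eta>. frechet_derivative (\<lambda>y. K y \<xi> \<eta>) (at x) h) = (\<lambda>\<xi> \<eta>. \<Sum>i\<in>Basis. \<Sum>j\<in>Basis.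
        frechet_derivative (\<lambda>y. K y (blinfun_inner_left i) (blinfun_inner_left j)) (at x) h * (\<xi> i * \<eta> j))"
      by (intro ext bivector_family_frechet_derivative_expansion[OF assms])
    then show ?thesis by (simp only: bounded_bilinear_dual_form)
  qed
  show "\<forall>\<xi>. frechet_derivative (\<lambda>y. K y \<xi> \<xi>) (at x) h = 0"
  proof
    fix \<xi>
    have "((\<lambda>y. K y \<xi> \<xi>) has_derivative (\<lambda>_. 0)) (at x)"
      by (rule has_derivative_transform_within_open[OF has_derivative_const S]) (use K in \<open>simp add: bivector_def\<close>)
    from frechet_derivative_at[OF this, symmetric] show "frechet_derivative (\<lambda>y. K y \<xi> \<xi>) (at x) h = 0" by simp
  qed
qed

text \<open>The product rule when the bivector and both of its arguments move. It is meant for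
  covectors pulled back along the derivative of a transition map, which depends on the
  point.\<close>

lemma bivector_family_has_derivative:
  fixes K :: "'a::real_normed_vector \<Rightarrow> 'v::euclidean_space bivec" and \<alpha> \<gamma> :: "'a \<Rightarrow> 'v dual" and \<alpha>' \<gamma>' :: "'a \<Rightarrow> 'v dual"
  assumes S: "open S" "x \<in> S" and K: "\<And>y. y \<in> S \<Longrightarrow> bivector (K y)"
    and dK: "\<And>\<xi> \<eta>. (\<lambda>y. K y \<xi> \<eta>) differentiable (at x)"
    and \<alpha>: "\<And>i. i \<in> Basis \<Longrightarrow> ((\<lambda>y. \<alpha> y i) has_derivative (\<lambda>h. \<alpha>' h i)) (at x)"
    and \<gamma>: "\<And>i. i \<in> Basis \<Longrightarrow> ((\<lambda>y. \<gamma> y i) has_derivative (\<lambda>h. \<gamma>' h i)) (at x)"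
  shows "((\<lambda>y. K y (\<alpha> y) (\<gamma> y)) has_derivative
     (\<lambda>h. frechet_derivative (\<lambda>y. K y (\<alpha> x) (\<gamma> x)) (at x) h + K x (\<alpha>' h) (\<gamma> x) + K x (\<alpha> x) (\<gamma>' h))) (at x)"
proof -
  define k where "k i j y = K y (blinfun_inner_left i) (blinfun_inner_left j)" for i j y
  define k' where "k' i j = frechet_derivative (k i j) (at x)" for i j
  have dk: "(k i j has_derivative k' i j) (at x)" for i j
    using dK unfolding k_def[abs_def] k'_def frechet_derivative_works .
  have exp: "K y \<xi> \<eta> = (\<Sum>i\<in>Basis. \<Sum>j\<in>Basis. k i j y * (\<xi> i * \<eta> j))" if "y \<in> S" for y \<xi> \<eta>
    unfolding k_def by (rule bivector_basis_expansion[OF K[OF that]])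
  have fK: "frechet_derivative (\<lambda>y. K y (\<alpha> x) (\<gamma> x)) (at x) h = (\<Sum>i\<in>Basis. \<Sum>j\<in>Basis. k' i j h * (\<alpha> x i * \<gamma> x j))" for h
    unfolding k'_def k_def[abs_def] by (rule bivector_family_frechet_derivative_expansion[OF S K dK])
  have "((\<lambda>y. \<Sum>i\<in>Basis. \<Sum>j\<in>Basis. k i j y * (\<alpha> y i * \<gamma> y j)) has_derivative
     (\<lambda>h. \<Sum>i\<in>Basis. \<Sum>j\<in>Basis. k i j x * (\<alpha> x i * \<gamma>' h j + \<alpha>' h i * \<gamma> x j) + k' i j h * (\<alpha> x i * \<gamma> x j))) (at x)"
    by (intro has_derivative_sum has_derivative_mult dk \<alpha> \<gamma>)
  also have "(\<lambda>h. \<Sum>i\<in>Basis. \<Sum>j\<in>Basis. k i j x * (\<alpha> x i * \<gamma>' h j + \<alpha>' h i * \<gamma> x j) + k' i j h * (\<alpha> x i * \<gamma> x j))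
     = (\<lambda>h. frechet_derivative (\<lambda>y. K y (\<alpha> x) (\<gamma> x)) (at x) h + K x (\<alpha>' h) (\<gamma> x) + K x (\<alpha> x) (\<gamma>' h))"
    unfolding fK exp[OF S(2)] by (simp add: sum.distrib algebra_simps)
  finally show ?thesis
    by (rule has_derivative_transform_within_open[OF _ S]) (simp add: exp)
qed

text \<open>As \<open>k\<close> vanishes at \<open>x\<close>, a limit of \<open>g\<close> suffices.
  The remainder splits into (k y - k'(y - x)) g y, where the first factor is o(|y - x|) and the
  second converges, and k'(y - x) (g y - l), where the first factor is O(|y - x|) and the second
  tends to 0.\<close>

lemma has_derivative_mult_vanishing:
  fixes k g :: "'a::real_normed_vector \<Rightarrow> real"
  assumes k: "(k has_derivative k') (at x)" "k x = 0" and g: "(g \<longlongrightarrow> l) (at x)"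
  shows "((\<lambda>y. k y * g y) has_derivative (\<lambda>h. k' h * l)) (at x)"
  unfolding has_derivative_at_within
proof
  have bl: "bounded_linear k'" using k(1) by (rule has_derivative_bounded_linear)
  show "bounded_linear (\<lambda>h. k' h * l)"
    by (rule bounded_linear_mult_const[OF bl])
  have 1: "((\<lambda>y. (1 / norm (y - x)) * (k y - k' (y - x))) \<longlongrightarrow> 0) (at x)"
    using k unfolding has_derivative_at_within by (simp add: divide_inverse mult.commute)
  obtain C where C: "\<And>h. norm (k' h) \<le> norm h * C" using bounded_linear.bounded[OF bl] by blast
  have 2: "((\<lambda>y. k' (y - x) / norm (y - x) * (g y - l)) \<longlongrightarrow> 0) (at x)"
  proof (rule Lim_null_comparison)
    \<comment> \<open>The absolute value covers a negative \<open>C\<close>. At h = 0 the quotient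
      is 0 by the convention for division, so the bound holds for every h.\<close>
    have "norm (k' h / norm h * r) \<le> \<bar>C\<bar> * \<bar>r\<bar>" for h r
    proof -
      have "\<bar>k' h\<bar> / norm h \<le> \<bar>C\<bar>"
      proof (cases "h = 0")
        case False
        have "\<bar>k' h\<bar> \<le> \<bar>C\<bar> * norm h"
          using C[of h] by (smt (verit) mult.commute mult_right_mono norm_ge_zero real_norm_def)
        with False show ?thesis by (simp add: divide_le_eq)
      qed simp
      from mult_right_mono[OF this, of "\<bar>r\<bar>"] show ?thesis by (simp add: abs_mult)
    qed
    then show "\<forall>\<^sub>F y in at x. norm (k' (y - x) / norm (y - x) * (g y - l)) \<le> \<bar>C\<bar> * \<bar>g y - l\<bar>"
      by simp
    have "((\<lambda>y. \<bar>C\<bar> * \<bar>g y - l\<bar>) \<longlongrightarrow> \<bar>C\<bar> * \<bar>l - l\<bar>) (at x)"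
      by (intro tendsto_intros g)
    then show "((\<lambda>y. \<bar>C\<bar> * \<bar>g y - l\<bar>) \<longlongrightarrow> 0) (at x)" by simp
  qed
  have "((\<lambda>y. (1 / norm (y - x)) * (k y - k' (y - x)) * g y + k' (y - x) / norm (y - x) * (g y - l)) \<longlongrightarrow> 0 * l + 0) (at x)"
    by (intro tendsto_add tendsto_mult 1 2 g)
  then show "((\<lambda>y. ((k y * g y - k x * g x) - k' (y - x) * l) /\<^sub>R norm (y - x)) \<longlongrightarrow> 0) (at x)"
    by (simp add: k(2) field_simps diff_divide_distrib add_divide_distrib)
qed

text \<open>To be used with \<open>T y\<close> the derivative of a right translation. Pointwise
  convergence of \<open>T\<close> to the identity is enough, because after expansion in coefficients
  \<open>T y\<close> only meets basis vectors.\<close>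

lemma vanishing_bivector_family_has_derivative:
  fixes K :: "'a::real_normed_vector \<Rightarrow> 'v::euclidean_space bivec" and T :: "'a \<Rightarrow> 'v \<Rightarrow>\<^sub>L 'v"
  assumes S: "open S" "x \<in> S" and K: "\<And>y. y \<in> S \<Longrightarrow> bivector (K y)"
    and dK: "\<And>\<xi> \<eta>. ((\<lambda>y. K y \<xi> \<eta>) has_derivative (\<lambda>h. K' h \<xi> \<eta>)) (at x)"
    and K0: "\<And>\<xi> \<eta>. K x \<xi> \<eta> = 0"
    and T: "\<And>a. ((\<lambda>y. blinfun_apply (T y) a) \<longlongrightarrow> a) (at x)"
  shows "((\<lambda>y. wedge_map (T y) (K y) \<xi> \<eta>) has_derivative (\<lambda>h. K' h \<xi> \<eta>)) (at x)"
proof -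
  define k where "k i j y = K y (blinfun_inner_left i) (blinfun_inner_left j)" for i j y
  define k' where "k' i j h = K' h (blinfun_inner_left i) (blinfun_inner_left j)" for i j h
  have dk: "(k i j has_derivative k' i j) (at x)" and k0: "k i j x = 0" for i j
    using dK K0 unfolding k_def[abs_def] k'_def[abs_def] by auto
  have exp: "K y \<xi> \<eta> = (\<Sum>i\<in>Basis. \<Sum>j\<in>Basis. k i j y * (\<xi> i * \<eta> j))" if "y \<in> S" for y \<xi> \<eta>
    unfolding k_def by (rule bivector_basis_expansion[OF K[OF that]])
  have "((\<lambda>y. \<Sum>i\<in>Basis. \<Sum>j\<in>Basis. k i j y * (\<xi> i * \<eta> j)) has_derivative
     (\<lambda>h. \<Sum>i\<in>Basis. \<Sum>j\<in>Basis. k' i j h * (\<xi> i * \<eta> j))) (at x)"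
    by (intro has_derivative_sum has_derivative_mult_left dk)
  then have "((\<lambda>y. K y \<xi> \<eta>) has_derivative
     (\<lambda>h. \<Sum>i\<in>Basis. \<Sum>j\<in>Basis. k' i j h * (\<xi> i * \<eta> j))) (at x)"
    by (rule has_derivative_transform_within_open[OF _ S]) (simp add: exp)
  then have K': "(\<lambda>h. K' h \<xi> \<eta>) = (\<lambda>h. \<Sum>i\<in>Basis. \<Sum>j\<in>Basis. k' i j h * (\<xi> i * \<eta> j))"
    by (rule has_derivative_unique[OF dK])
  have "((\<lambda>y. \<Sum>i\<in>Basis. \<Sum>j\<in>Basis. k i j y * (\<xi> (T y i) * \<eta> (T y j))) has_derivative
     (\<lambda>h. \<Sum>i\<in>Basis. \<Sum>j\<in>Basis. k' i j h * (\<xi> i * \<eta> j))) (at x)"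
    by (intro has_derivative_sum has_derivative_mult_vanishing dk k0 tendsto_mult
        blinfun.tendsto tendsto_const T)
  then show ?thesis
    unfolding K' by (rule has_derivative_transform_within_open[OF _ S]) (simp add: wedge_map_def exp)
qed

section \<open>The tangent lift expressed through base and fibre parts of covectors\<close>

definition base_part :: "('v::real_normed_vector \<times> 'v) dual \<Rightarrow> 'v dual" where
  "base_part \<xi> = \<xi> o\<^sub>L Blinfun (\<lambda>v. (v, 0))"

definition fibre_part :: "('v::real_normed_vector \<times> 'v) dual \<Rightarrow> 'v dual" where
  "fibre_part \<xi> = \<xi> o\<^sub>L Blinfun (\<lambda>v. (0, v))"

lemma Blinfun_Pair_apply:
  "blinfun_apply (Blinfun (\<lambda>v. (v, 0))) u = (u, 0)"
  "blinfun_apply (Blinfun (\<lambda>v. (0, v))) w = (0, w)"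
  by (simp_all add: bounded_linear_Blinfun_apply bounded_linear_Pair bounded_linear_ident bounded_linear_zero)

lemma base_part_apply [simp]: "base_part \<xi> v = \<xi> (v, 0)"
  and fibre_part_apply [simp]: "fibre_part \<xi> v = \<xi> (0, v)"
  by (simp_all add: base_part_def fibre_part_def Blinfun_Pair_apply)

text \<open>The coordinate formula of the tangent lift without indices. The mixed wedges give the
  first two terms, the second with a plus sign by antisymmetry of \<open>K\<close>; the purely
  vertical wedges give the derivative term.\<close>

definition lift_in_chart ::
    "('v::real_normed_vector \<Rightarrow> 'v bivec) \<Rightarrow> 'v \<times> 'v \<Rightarrow> ('v \<times> 'v) bivec" where
  "lift_in_chart K z \<xi> \<eta> = K (fst z) (base_part \<xi>) (fibre_part \<eta>) + K (fst z) (fibre_part \<xi>) (base_part \<eta>)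
     + frechet_derivative (\<lambda>y. K y (fibre_part \<xi>) (fibre_part \<eta>)) (at (fst z)) (snd z)"

text \<open>On equal arguments the two mixed terms cancel by antisymmetry of \<open>K\<close>, and
  the derivative term vanishes because a derivative of alternating forms is alternating.\<close>

lemma bivector_lift_in_chart:
  fixes K :: "'v::euclidean_space \<Rightarrow> 'v bivec"
  assumes S: "open S" "fst z \<in> S" and K: "\<And>y. y \<in> S \<Longrightarrow> bivector (K y)"
    and dK: "\<And>\<xi> \<eta>. (\<lambda>y. K y \<xi> \<eta>) differentiable (at (fst z))"
  shows "bivector (lift_in_chart K z)"
proof -
  have l: "bounded_linear (\<lambda>\<xi>. base_part \<xi>)" "bounded_linear (\<lambda>\<xi>. fibre_part \<xi>)"
    unfolding base_part_def fibre_part_def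
    by (rule bounded_bilinear.bounded_linear_left[OF bounded_bilinear_blinfun_compose])+
  have "bounded_bilinear (K (fst z))" using K[OF S(2)] by (simp add: bivector_def)
  note 1 = bounded_bilinear.comp[OF this l] bounded_bilinear.comp[OF this l(2,1)]
  define D where "D \<xi> \<eta> = frechet_derivative (\<lambda>y. K y \<xi> \<eta>) (at (fst z)) (snd z)" for \<xi> \<eta>
  have D: "bivector D"
    unfolding D_def[abs_def] by (rule bivector_frechet_derivative[OF assms])
  then have "bounded_bilinear (\<lambda>\<xi> \<eta>. D (fibre_part \<xi>) (fibre_part \<eta>))"
    unfolding bivector_def by (intro bounded_bilinear.comp[OF _ l(2,2)]) simp
  then have "bounded_bilinear (lift_in_chart K z)"
    unfolding lift_in_chart_def[abs_def] D_def[symmetric] by (intro bounded_bilinear_add 1)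
  moreover have "lift_in_chart K z \<xi> \<xi> = 0" for \<xi>
  proof -
    have "D (fibre_part \<xi>) (fibre_part \<xi>) = 0" using D by (simp add: bivector_def)
    then show ?thesis
      unfolding lift_in_chart_def D_def
      using bivector_antisym[OF K[OF S(2)], of "base_part \<xi>" "fibre_part \<xi>"] by linarith
  qed
  ultimately show ?thesis by (simp add: bivector_def)
qed

text \<open>Each wedge contributes a difference of two products. Antisymmetry turns the mixed
  difference into a sum and doubles the vertical term, which cancels the factor 1/2.\<close>

lemma tangent_lift_eq_lift_in_chart:
  fixes M :: "('p, 'e::euclidean_space) manifold"
  defines "c p \<equiv> chart_at M p"
  assumes S: "open S" "snd (c p) p \<in> S" and K: "\<And>y. y \<in> S \<Longrightarrow> bivector (bivec_in_chart M \<Lambda> (c p) y)"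
    and dK: "\<And>\<xi> \<eta>. (\<lambda>y. bivec_in_chart M \<Lambda> (c p) y \<xi> \<eta>) differentiable (at (snd (c p) p))"
  shows "tangent_lift M \<Lambda> (p, v) = lift_in_chart (bivec_in_chart M \<Lambda> (c p)) (snd (c p) p, v)"
proof (intro ext)
  fix \<xi> \<eta> :: "('e \<times> 'e) dual"
  define x where "x = snd (c p) p"
  define L where "L = bivec_in_chart M \<Lambda> (c p)"
  define l where "l i j = L x (blinfun_inner_left i) (blinfun_inner_left j)" for i j
  define D where "D \<xi> \<eta> = frechet_derivative (\<lambda>y. L y \<xi> \<eta>) (at x) v" for \<xi> \<eta>
  define d where "d i j = D (blinfun_inner_left i) (blinfun_inner_left j)" for i j
  have x: "x \<in> S" using S by (simp add: x_def)
  have l: "L x \<xi> \<eta> = (\<Sum>i\<in>Basis. \<Sum>j\<in>Basis. l i j * (\<xi> i * \<eta> j))" for \<xi> \<eta>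
    unfolding l_def by (rule bivector_basis_expansion) (simp add: L_def K[OF x])
  have d: "D \<xi> \<eta> = (\<Sum>i\<in>Basis. \<Sum>j\<in>Basis. d i j * (\<xi> i * \<eta> j))" for \<xi> \<eta>
    unfolding D_def d_def L_def x_def
    by (rule bivector_family_frechet_derivative_expansion[OF S K dK])
  have D_antisym: "D \<xi> \<eta> = - D \<eta> \<xi>" for \<xi> \<eta>
    unfolding D_def L_def x_def
    by (rule bivector_antisym[OF bivector_frechet_derivative[OF S K dK]])
  have L_antisym: "L x \<xi> \<eta> = - L x \<eta> \<xi>" for \<xi> \<eta>
    using bivector_antisym[OF K[OF x]] unfolding L_def .
  have cf: "coeff M \<Lambda> (c p) i j = (\<lambda>y. L y (blinfun_inner_left i) (blinfun_inner_left j))" for i j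
    by (simp add: coeff_def L_def fun_eq_iff)
  have dc: "(\<Sum>k\<in>Basis. dcoeff M \<Lambda> (c p) k i j x * (v \<bullet> k)) = d i j" for i j
  proof -
    have "(\<lambda>y. L y (blinfun_inner_left i) (blinfun_inner_left j)) differentiable (at x)"
      using dK by (simp add: L_def x_def)
    from frechet_derivative_basis_expansion[OF this, of v]
    show ?thesis by (simp add: dcoeff_def cf d_def D_def mult.commute)
  qed
  have "tangent_lift M \<Lambda> (p, v) \<xi> \<eta> =
      (\<Sum>i\<in>Basis. \<Sum>j\<in>Basis. l i j * (\<xi> (i, 0) * \<eta> (0, j) - \<xi> (0, j) * \<eta> (i, 0)))
    + 1/2 * (\<Sum>i\<in>Basis. \<Sum>j\<in>Basis. d i j * (\<xi> (0, i) * \<eta> (0, j) - \<xi> (0, j) * \<eta> (0, i)))"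
    unfolding tangent_lift_def Let_def case_prod_conv c_def[symmetric] x_def[symmetric] dc wedge_def cf l_def ..
  also have "(\<Sum>i\<in>Basis. \<Sum>j\<in>Basis. l i j * (\<xi> (i, 0) * \<eta> (0, j) - \<xi> (0, j) * \<eta> (i, 0)))
      = L x (base_part \<xi>) (fibre_part \<eta>) - L x (base_part \<eta>) (fibre_part \<xi>)"
    by (simp add: l right_diff_distrib sum_subtractf mult_ac)
  also have "(\<Sum>i\<in>Basis. \<Sum>j\<in>Basis. d i j * (\<xi> (0, i) * \<eta> (0, j) - \<xi> (0, j) * \<eta> (0, i)))
      = D (fibre_part \<xi>) (fibre_part \<eta>) - D (fibre_part \<eta>) (fibre_part \<xi>)"
    by (simp add: d right_diff_distrib sum_subtractf mult_ac)
  finally show "tangent_lift M \<Lambda> (p, v) \<xi> \<eta> = lift_in_chart (bivec_in_chart M \<Lambda> (c p)) (snd (c p) p, v) \<xi> \<eta>"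
    using L_antisym[of "base_part \<eta>" "fibre_part \<xi>"] D_antisym[of "fibre_part \<eta>" "fibre_part \<xi>"]
    by (simp add: lift_in_chart_def D_def flip: L_def x_def)
qed

text \<open>Coordinate invariance. With A the derivative of the transition \<phi>, the local forms
  satisfy L(\<phi> y)(\<xi>, \<eta>) = K y (\<xi> A(y), \<eta> A(y)). Differentiating along
  \<open>u\<close> produces two terms with the derivative of A; the off-diagonal block of the
  tangent transition produces two terms with \<open>B u\<close>. They coincide because second
  derivatives are symmetric.\<close>

lemma tangent_lift_in_chart:
  fixes M :: "('p, 'e::euclidean_space) manifold"
  assumes M: "smooth_manifold M" and \<Lambda>: "bivector_field M \<Lambda>" and c: "c \<in> atlas M" "p \<in> fst c"
  shows "wedge_map (components (tangent_bundle M) (tangent_chart M c) (p, u)) (tangent_lift M \<Lambda> (p, u))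
     = lift_in_chart (bivec_in_chart M \<Lambda> c) (snd c p, components M c p u)"
proof (intro ext)
  fix \<xi> \<eta> :: "('e \<times> 'e) dual"
  have p: "p \<in> points M" using smooth_manifold_chart_subset[OF M c] .
  define b where "b = chart_at M p"
  have b: "b \<in> atlas M" "p \<in> fst b" using smooth_manifold_chart_at[OF M p] by (auto simp: b_def)
  note cb = smooth_manifold_coordinate_chart[OF M b(1)] and cc = smooth_manifold_coordinate_chart[OF M c(1)]
  define \<phi> where "\<phi> = transition b c"
  define x where "x = snd b p"
  define S where "S = snd b ` (fst b \<inter> fst c)"
  have S: "open S" "smooth_on S \<phi>" "x \<in> S"
    using smooth_on_transition[OF M b(1) c(1)] b c by (auto simp: S_def \<phi>_def x_def)
  define A where "A y = frechet_derivative \<phi> (at y)" for y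
  define B where "B h = second_derivative \<phi> x h" for h
  have A: "(\<phi> has_derivative A y) (at y)" if "y \<in> S" for y
    unfolding A_def by (rule smooth_on_has_derivative[OF S(2) that])
  have blA: "bounded_linear (A y)" if "y \<in> S" for y
    using has_derivative_bounded_linear[OF A[OF that]] .
  have blB: "bounded_linear (B h)" for h
    unfolding B_def using linear_second_derivative[OF S(2,3)] by (simp add: linear_conv_bounded_linear)
  define K where "K = bivec_in_chart M \<Lambda> b"
  define L where "L = bivec_in_chart M \<Lambda> c"
  have \<phi>x: "\<phi> x = snd c p" by (simp add: \<phi>_def x_def chart_expression_def chart_inv_apply[OF cb b(2)])
  have im: "open (chart_image b)" "x \<in> chart_image b" "S \<subseteq> chart_image b" "open (chart_image c)" "\<phi> x \<in> chart_image c"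
    using cb cc b c \<phi>x by (auto simp: coordinate_chart_def x_def S_def chart_image_def)
  have biv: "bivector (K y)" if "y \<in> chart_image b" for y
    unfolding K_def using bivector_bivec_in_chart[OF M \<Lambda> b(1) that] .
  have dK: "(\<lambda>y. K y \<xi> \<eta>) differentiable (at x)" for \<xi> \<eta>
    unfolding K_def using smooth_on_imp_differentiable[OF smooth_on_bivec_in_chart[OF \<Lambda> b(1)] im(2)] .
  have dL: "(\<lambda>y. L y \<xi> \<eta>) differentiable (at (\<phi> x))" for \<xi> \<eta>
    unfolding L_def using smooth_on_imp_differentiable[OF smooth_on_bivec_in_chart[OF \<Lambda> c(1)] im(5)] .
  have LK: "L (\<phi> y) \<xi> \<eta> = K y (\<xi> o\<^sub>L Blinfun (A y)) (\<eta> o\<^sub>L Blinfun (A y))" if y: "y \<in> S" for y \<xi> \<eta>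
  proof -
    obtain q where q: "q \<in> fst b" "q \<in> fst c" "y = snd b q" using y by (auto simp: S_def)
    have \<phi>y: "\<phi> y = snd c q" by (simp add: \<phi>_def q(3) chart_expression_def chart_inv_apply[OF cb q(1)])
    have "components M c q = Blinfun (A y) o\<^sub>L components M b q"
      by (rule blinfun_eqI)
         (simp add: components_transition[OF M b(1) c(1) q(1,2)] bounded_linear_Blinfun_apply[OF blA[OF y]],
          simp add: A_def \<phi>_def q(3))
    then show ?thesis
      unfolding L_def K_def \<phi>y bivec_in_chart_apply[OF cc q(2)] unfolding q(3) bivec_in_chart_apply[OF cb q(1)]
      by (simp add: wedge_map_def blinfun_compose_assoc)
  qed
  \<comment> \<open>\<open>b\<close> is the preferred chart at \<open>p\<close>, in which a tangent
    vector is its own component vector.\<close>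
  have comp_u: "components M b p u = u" using components_chart_at[OF M p] by (simp add: b_def)
  have chTM: "chart_at (tangent_bundle M) (p, u) = tangent_chart M b"
    by (simp add: tangent_bundle_def b_def)
  define T where "T = components (tangent_bundle M) (tangent_chart M c) (p, u)"
  have "chart_deriv (tangent_chart M b) (tangent_chart M c) (\<lambda>z. z) (p, u) (\<lambda>w. (A x (fst w), B u (fst w) + A x (snd w)))"
    using chart_deriv_tangent_transition[OF M b(1) c(1) b(2) c(2), of u]
    by (simp add: comp_u A_def B_def x_def \<phi>_def)
  then have T: "blinfun_apply T = (\<lambda>w. (A x (fst w), B u (fst w) + A x (snd w)))"
    unfolding T_def by (intro components_eqI) (simp add: chTM)
  let ?A = "Blinfun (A x)" and ?B = "Blinfun (B u)"
  have A0: "A x 0 = 0" and B0: "B u 0 = 0"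
    using blA[OF S(3)] blB linear_simps by (auto simp: bounded_linear.linear linear_0)
  \<comment> \<open>\<open>T\<close> sends (v, 0) to (A v, B u v), so the fibre part of \<xi> leaks
    into the base part of its pullback.\<close>
  have base: "base_part (\<xi> o\<^sub>L T) = (base_part \<xi> o\<^sub>L ?A) + (fibre_part \<xi> o\<^sub>L ?B)" for \<xi>
    by (rule blinfun_eqI)
       (simp add: T A0 blinfun.add_left bounded_linear_Blinfun_apply blA[OF S(3)] blB flip: blinfun.add_right)
  have fibre: "fibre_part (\<xi> o\<^sub>L T) = fibre_part \<xi> o\<^sub>L ?A" for \<xi>
    by (rule blinfun_eqI) (simp add: T A0 B0 bounded_linear_Blinfun_apply blA[OF S(3)])
  define \<xi>f \<eta>f where "\<xi>f = fibre_part \<xi>" and "\<eta>f = fibre_part \<eta>"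
  have dA: "((\<lambda>y. blinfun_apply (\<zeta> o\<^sub>L Blinfun (A y)) i) has_derivative
      (\<lambda>h. blinfun_apply (\<zeta> o\<^sub>L Blinfun (B h)) i)) (at x)" for \<zeta> :: "'e dual" and i
  proof -
    have "((\<lambda>y. A y i) has_derivative second_derivative \<phi> x i) (at x)"
      unfolding A_def second_derivative_def
      by (rule smooth_on_has_derivative[OF smooth_on_frechet_derivative[OF S(2)] S(3)])
    then have "((\<lambda>y. \<zeta> (A y i)) has_derivative (\<lambda>h. \<zeta> (second_derivative \<phi> x i h))) (at x)"
      by (rule bounded_linear.has_derivative[OF blinfun.bounded_linear_right])
    \<comment> \<open>Symmetry enters here: differentiating A in direction h gives a second
      derivative with first direction i, whereas \<open>B h\<close> has first direction h.\<close>
    also have "(\<lambda>h. \<zeta> (second_derivative \<phi> x i h)) = (\<lambda>h. blinfun_apply (\<zeta> o\<^sub>L Blinfun (B h)) i)"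
      using second_derivative_symmetric[OF S(1,3,2), of i] by (simp add: bounded_linear_Blinfun_apply[OF blB[unfolded B_def]] B_def)
    finally show ?thesis
      by (rule has_derivative_transform_within_open[OF _ S(1,3)]) (simp add: bounded_linear_Blinfun_apply[OF blA])
  qed
  have "((\<lambda>y. K y (\<xi>f o\<^sub>L Blinfun (A y)) (\<eta>f o\<^sub>L Blinfun (A y))) has_derivative
     (\<lambda>h. frechet_derivative (\<lambda>y. K y (\<xi>f o\<^sub>L ?A) (\<eta>f o\<^sub>L ?A)) (at x) h
        + K x (\<xi>f o\<^sub>L Blinfun (B h)) (\<eta>f o\<^sub>L ?A) + K x (\<xi>f o\<^sub>L ?A) (\<eta>f o\<^sub>L Blinfun (B h)))) (at x)"
    by (rule bivector_family_has_derivative[OF im(1,2) biv dK dA dA])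
  then have 1: "((\<lambda>y. L (\<phi> y) \<xi>f \<eta>f) has_derivative
     (\<lambda>h. frechet_derivative (\<lambda>y. K y (\<xi>f o\<^sub>L ?A) (\<eta>f o\<^sub>L ?A)) (at x) h
        + K x (\<xi>f o\<^sub>L Blinfun (B h)) (\<eta>f o\<^sub>L ?A) + K x (\<xi>f o\<^sub>L ?A) (\<eta>f o\<^sub>L Blinfun (B h)))) (at x)"
    by (rule has_derivative_transform_within_open[OF _ S(1,3)]) (simp add: LK)
  have 2: "((\<lambda>y. L (\<phi> y) \<xi>f \<eta>f) has_derivative
     (\<lambda>h. frechet_derivative (\<lambda>y. L y \<xi>f \<eta>f) (at (\<phi> x)) (A x h))) (at x)"
    by (rule has_derivative_compose[OF A[OF S(3)] dL[unfolded frechet_derivative_works]])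
  \<comment> \<open>The two computations of the derivative of y \<mapsto> L(\<phi> y), compared in
    the direction \<open>u\<close>.\<close>
  have D: "frechet_derivative (\<lambda>y. L y \<xi>f \<eta>f) (at (\<phi> x)) (A x u) =
      frechet_derivative (\<lambda>y. K y (\<xi>f o\<^sub>L ?A) (\<eta>f o\<^sub>L ?A)) (at x) u
        + K x (\<xi>f o\<^sub>L ?B) (\<eta>f o\<^sub>L ?A) + K x (\<xi>f o\<^sub>L ?A) (\<eta>f o\<^sub>L ?B)"
    using fun_cong[OF has_derivative_unique[OF 2 1], of u] .
  have cu: "components M c p u = A x u"
    using components_transition[OF M b(1) c(1) b(2) c(2), of u] by (simp add: comp_u A_def \<phi>_def x_def)
  have "tangent_lift M \<Lambda> (p, u) = lift_in_chart K (x, u)"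
    unfolding K_def x_def b_def
    by (rule tangent_lift_eq_lift_in_chart[where S = "chart_image b"])
       (use im biv dK in \<open>auto simp: K_def x_def b_def\<close>)
  then have "wedge_map T (tangent_lift M \<Lambda> (p, u)) \<xi> \<eta> = lift_in_chart K (x, u) (\<xi> o\<^sub>L T) (\<eta> o\<^sub>L T)"
    by (simp add: wedge_map_def)
  also have "\<dots> = lift_in_chart L (\<phi> x, A x u) \<xi> \<eta>"
  proof -
    interpret bounded_bilinear "K x" using biv[OF im(2)] by (simp add: bivector_def)
    show ?thesis
      unfolding lift_in_chart_def base fibre add_left add_right fst_conv snd_conv LK[OF S(3)]
      using D unfolding \<xi>f_def \<eta>f_def by simp
  qed
  finally show "wedge_map (components (tangent_bundle M) (tangent_chart M c) (p, u)) (tangent_lift M \<Lambda> (p, u)) \<xi> \<eta>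
     = lift_in_chart (bivec_in_chart M \<Lambda> c) (snd c p, components M c p u) \<xi> \<eta>"
    by (simp add: T_def L_def cu \<phi>x)
qed

section \<open>Lie groups and their tangent groups\<close>

locale smooth_group =
  fixes G :: "'p monoid" and M :: "('p, 'e::euclidean_space) manifold"
  assumes lie_group: "lie_group G M"
begin

lemma group: "group G" and manifold: "smooth_manifold M" and carrier: "carrier G = points M"
  using lie_group by (auto simp: lie_group_def)

lemma smooth_mult: "smooth_map (product_manifold M M) M (\<lambda>(g, h). g \<otimes>\<^bsub>G\<^esub> h)"
  and smooth_inv: "smooth_map M M (\<lambda>g. inv\<^bsub>G\<^esub> g)"
  using lie_group by (auto simp: lie_group_def)

abbreviation mult_map :: "'p \<times> 'p \<Rightarrow> 'p" where
  "mult_map \<equiv> \<lambda>(g, h). g \<otimes>\<^bsub>G\<^esub> h"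

abbreviation Tmult :: "'p \<Rightarrow> 'p \<Rightarrow> 'e \<times> 'e \<Rightarrow> 'e" where
  "Tmult g h \<equiv> blinfun_apply (tangent_map_at (product_manifold M M) M mult_map (g, h))"

abbreviation Tinv :: "'p \<Rightarrow> 'e \<Rightarrow> 'e" where
  "Tinv g \<equiv> blinfun_apply (tangent_map_at M M (\<lambda>g. inv\<^bsub>G\<^esub> g) g)"

abbreviation unit_chart :: "('p, 'e) chart" where
  "unit_chart \<equiv> chart_at M \<one>\<^bsub>G\<^esub>"

abbreviation unit_coords :: 'e where
  "unit_coords \<equiv> snd unit_chart \<one>\<^bsub>G\<^esub>"

section \<open>Multiplication and inversion in the unit chart\<close>

definition mult_expr :: "'e \<times> 'e \<Rightarrow> 'e" where
  "mult_expr = chart_expression (product_chart unit_chart unit_chart) unit_chart mult_map"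

definition inv_expr :: "'e \<Rightarrow> 'e" where
  "inv_expr = chart_expression unit_chart unit_chart (\<lambda>g. inv\<^bsub>G\<^esub> g)"

definition mult_dom :: "('e \<times> 'e) set" where
  "mult_dom = snd (product_chart unit_chart unit_chart) `
     (fst (product_chart unit_chart unit_chart) \<inter> mult_map -` fst unit_chart)"

definition inv_dom :: "'e set" where
  "inv_dom = snd unit_chart ` (fst unit_chart \<inter> (\<lambda>g. inv\<^bsub>G\<^esub> g) -` fst unit_chart)"

lemma one_point: "\<one>\<^bsub>G\<^esub> \<in> points M"
  using group.is_monoid[OF group] monoid.one_closed carrier by metis

lemma unit_chart_atlas: "unit_chart \<in> atlas M" and one_in_unit_chart: "\<one>\<^bsub>G\<^esub> \<in> fst unit_chart"
  using smooth_manifold_chart_at[OF manifold one_point] by auto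

lemma coordinate_unit_chart: "coordinate_chart unit_chart"
  using smooth_manifold_coordinate_chart[OF manifold unit_chart_atlas] .

lemma in_carrier: "c \<in> atlas M \<Longrightarrow> g \<in> fst c \<Longrightarrow> g \<in> carrier G"
  using smooth_manifold_chart_subset[OF manifold] carrier by simp

lemma chart_at_carrier:
  "g \<in> carrier G \<Longrightarrow> chart_at M g \<in> atlas M" "g \<in> carrier G \<Longrightarrow> g \<in> fst (chart_at M g)"
  using smooth_manifold_chart_at[OF manifold] carrier by auto

lemma product_chart_atlas:
  "c \<in> atlas M \<Longrightarrow> d \<in> atlas M \<Longrightarrow> product_chart c d \<in> atlas (product_manifold M M)"
  unfolding product_manifold_def by (simp del: split_paired_Ex) blast

lemma chart_at_product: "chart_at (product_manifold M M) (g, h) = product_chart (chart_at M g) (chart_at M h)"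
  by (simp add: product_manifold_def)

lemma open_mult_dom: "open mult_dom" and smooth_mult_expr: "smooth_on mult_dom mult_expr"
  unfolding mult_dom_def mult_expr_def
  using smooth_on_chart_expression[OF smooth_mult product_chart_atlas[OF unit_chart_atlas unit_chart_atlas] unit_chart_atlas]
  by auto

lemma open_inv_dom: "open inv_dom" and smooth_inv_expr: "smooth_on inv_dom inv_expr"
  unfolding inv_dom_def inv_expr_def
  using smooth_on_chart_expression[OF smooth_inv unit_chart_atlas unit_chart_atlas] by auto

lemma in_mult_dom:
  assumes "g \<in> fst unit_chart" "h \<in> fst unit_chart" "g \<otimes>\<^bsub>G\<^esub> h \<in> fst unit_chart"
  shows "(snd unit_chart g, snd unit_chart h) \<in> mult_dom"
  unfolding mult_dom_def using assms
  by (intro image_eqI[of _ _ "(g, h)"]) (auto simp: product_chart_def)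

lemma mult_domD:
  assumes "(snd unit_chart g, snd unit_chart h) \<in> mult_dom" "g \<in> fst unit_chart" "h \<in> fst unit_chart"
  shows "g \<otimes>\<^bsub>G\<^esub> h \<in> fst unit_chart"
proof -
  obtain g' h' where gh: "g' \<in> fst unit_chart" "h' \<in> fst unit_chart" "g' \<otimes>\<^bsub>G\<^esub> h' \<in> fst unit_chart"
    "snd unit_chart g = snd unit_chart g'" "snd unit_chart h = snd unit_chart h'"
    using assms(1) by (auto simp: mult_dom_def product_chart_def)
  then have "g = g'" "h = h'"
    using assms(2,3) coordinate_unit_chart by (auto simp: coordinate_chart_def dest: inj_onD)
  with gh show ?thesis by simp
qed

lemma mult_expr_apply:
  assumes "g \<in> fst unit_chart" "h \<in> fst unit_chart"
  shows "mult_expr (snd unit_chart g, snd unit_chart h) = snd unit_chart (g \<otimes>\<^bsub>G\<^esub> h)"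
  by (simp add: mult_expr_def chart_expression_def chart_inv_product coordinate_unit_chart
      chart_image_apply chart_inv_apply assms)

lemma inv_expr_apply:
  "g \<in> fst unit_chart \<Longrightarrow> inv_expr (snd unit_chart g) = snd unit_chart (inv\<^bsub>G\<^esub> g)"
  by (simp add: inv_expr_def chart_expression_def chart_inv_apply[OF coordinate_unit_chart])

lemma chart_deriv_mult:
  assumes "c \<in> atlas M" "d \<in> atlas M" "b \<in> atlas M" "g \<in> fst c" "h \<in> fst d" "g \<otimes>\<^bsub>G\<^esub> h \<in> fst b"
  shows "chart_deriv (product_chart c d) b mult_map (g, h)
     (frechet_derivative (chart_expression (product_chart c d) b mult_map) (at (snd c g, snd d h)))"
  using chart_deriv_smooth[of "product_chart c d" b "(g, h)" mult_map]
    smooth_on_chart_expression[OF smooth_mult product_chart_atlas[OF assms(1,2)] assms(3)] assms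
    coordinate_chart_product[of c d] smooth_manifold_coordinate_chart[OF manifold assms(1)]
    smooth_manifold_coordinate_chart[OF manifold assms(2)] smooth_manifold_coordinate_chart[OF manifold assms(3)]
  by (simp add: product_chart_def)

lemma chart_deriv_unit_mult:
  assumes "g \<in> fst unit_chart" "h \<in> fst unit_chart" "g \<otimes>\<^bsub>G\<^esub> h \<in> fst unit_chart"
  shows "chart_deriv (product_chart unit_chart unit_chart) unit_chart mult_map (g, h)
     (frechet_derivative mult_expr (at (snd unit_chart g, snd unit_chart h)))"
  unfolding mult_expr_def using chart_deriv_mult[OF unit_chart_atlas unit_chart_atlas unit_chart_atlas assms] .

lemma chart_deriv_product_components:
  assumes "c \<in> atlas M" "d \<in> atlas M" "g \<in> fst c" "h \<in> fst d"
  shows "chart_deriv (chart_at (product_manifold M M) (g, h)) (product_chart c d) (\<lambda>q. q) (g, h)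
    (\<lambda>(u, w). (components M c g u, components M d h w))"
  using chart_deriv_map_prod[OF chart_deriv_components[OF manifold assms(1,3)] chart_deriv_components[OF manifold assms(2,4)]]
  by (simp add: chart_at_product case_prod_eta split_def)

text \<open>In induced coordinates the multiplication of the tangent group is thus
  \<open>tangent_fun mult_expr\<close>, up to the order of the four coordinates.\<close>

lemma components_Tmult:
  assumes "g \<in> fst unit_chart" "h \<in> fst unit_chart" "g \<otimes>\<^bsub>G\<^esub> h \<in> fst unit_chart"
  shows "components M unit_chart (g \<otimes>\<^bsub>G\<^esub> h) (Tmult g h (u, w))
    = frechet_derivative mult_expr (at (snd unit_chart g, snd unit_chart h))
        (components M unit_chart g u, components M unit_chart h w)"
  using components_tangent_map_at(1)[OF manifold chart_deriv_unit_mult[OF assms]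
      chart_deriv_product_components[OF unit_chart_atlas unit_chart_atlas assms(1,2)] unit_chart_atlas, of "(u, w)"] assms(3)
  by simp

text \<open>Stated for arbitrary elements in their preferred charts: inverses in the tangent group
  are computed over points that may lie far from the unit.\<close>

lemma chart_deriv_Tmult:
  assumes "g \<in> carrier G" "h \<in> carrier G"
  shows "chart_deriv (product_chart (chart_at M g) (chart_at M h)) (chart_at M (g \<otimes>\<^bsub>G\<^esub> h)) mult_map (g, h) (Tmult g h)"
proof -
  have gh: "g \<otimes>\<^bsub>G\<^esub> h \<in> carrier G" using group assms by (simp add: group.is_monoid monoid.m_closed)
  note c = chart_at_carrier[OF assms(1)] chart_at_carrier[OF assms(2)] chart_at_carrier[OF gh]
  have "chart_deriv (chart_at (product_manifold M M) (g, h)) (chart_at M (mult_map (g, h))) mult_map (g, h) (Tmult g h)"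
    by (rule components_tangent_map_at(2)[OF manifold chart_deriv_mult[OF c(1,3,5,2,4,6)]
        chart_deriv_product_components[OF c(1,3,2,4)] c(5)]) (simp add: c)
  then show ?thesis by (simp add: chart_at_product)
qed

lemma chart_deriv_Tinv:
  assumes "g \<in> carrier G"
  shows "chart_deriv (chart_at M g) (chart_at M (inv\<^bsub>G\<^esub> g)) (\<lambda>g. inv\<^bsub>G\<^esub> g) g (Tinv g)"
proof -
  have i: "inv\<^bsub>G\<^esub> g \<in> carrier G" using group assms by simp
  note c = chart_at_carrier[OF assms(1)] chart_at_carrier[OF i]
  show ?thesis
    by (rule components_tangent_map_at(2)[OF manifold
          chart_deriv_smooth_map[OF manifold manifold smooth_inv c(1,3,2,4)] chart_deriv_ident c(3,4)])
       (use c smooth_manifold_coordinate_chart[OF manifold] in auto)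
qed

text \<open>Left translation by g followed by left translation by its inverse is the identity, so by
  the chain rule the derivative of the former is injective. The contribution of \<open>v\<close> is
  removed by linearity.\<close>

lemma Tmult_left_cancel:
  assumes g: "g \<in> carrier G" and h: "h \<in> carrier G" and eq: "Tmult g h (v, w) = Tmult g h (v, w')"
  shows "w = w'"
proof -
  interpret group G by (rule group)
  have gh: "g \<otimes>\<^bsub>G\<^esub> h \<in> carrier G" and i: "inv\<^bsub>G\<^esub> g \<in> carrier G" using g h by auto
  note cg = chart_at_carrier[OF g] and ch = chart_at_carrier[OF h] and cgh = chart_at_carrier[OF gh] and ci = chart_at_carrier[OF i]
  note cc = smooth_manifold_coordinate_chart[OF manifold]
  have L: "chart_deriv (chart_at M h') (chart_at M (k \<otimes>\<^bsub>G\<^esub> h')) (\<lambda>y. k \<otimes>\<^bsub>G\<^esub> y) h' (\<lambda>s. Tmult k h' (0, s))"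
    if "k \<in> carrier G" "h' \<in> carrier G" for k h'
  proof -
    note c = chart_at_carrier[OF that(1)] chart_at_carrier[OF that(2)]
    have "chart_deriv (chart_at M h') (product_chart (chart_at M k) (chart_at M h')) (\<lambda>y. (k, y)) h' (\<lambda>s. (0, s))"
      by (intro chart_deriv_Pair chart_deriv_const chart_deriv_ident) (use c cc in auto)
    from chart_deriv_compose[OF this chart_deriv_Tmult[OF that]] show ?thesis by simp
  qed
  have e: "inv\<^bsub>G\<^esub> g \<otimes>\<^bsub>G\<^esub> (g \<otimes>\<^bsub>G\<^esub> h) = h" using g h by (simp flip: m_assoc)
  have "chart_deriv (chart_at M h) (chart_at M h) (\<lambda>y. inv\<^bsub>G\<^esub> g \<otimes>\<^bsub>G\<^esub> (g \<otimes>\<^bsub>G\<^esub> y)) h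
      (\<lambda>s. Tmult (inv\<^bsub>G\<^esub> g) (g \<otimes>\<^bsub>G\<^esub> h) (0, Tmult g h (0, s)))"
    using chart_deriv_compose[OF L[OF g h] L[OF i gh]] by (simp add: e)
  then have "chart_deriv (chart_at M h) (chart_at M h) (\<lambda>y. y) h
      (\<lambda>s. Tmult (inv\<^bsub>G\<^esub> g) (g \<otimes>\<^bsub>G\<^esub> h) (0, Tmult g h (0, s)))"
    by (rule chart_deriv_cong) (use g in_carrier[OF ch(1)] in \<open>simp flip: m_assoc\<close>)
  from chart_deriv_unique[OF this chart_deriv_ident[OF cc[OF ch(1)] ch(2)]]
  have *: "Tmult (inv\<^bsub>G\<^esub> g) (g \<otimes>\<^bsub>G\<^esub> h) (0, Tmult g h (0, s)) = s" for s
    by (simp add: fun_eq_iff)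
  have "Tmult g h (0, w) = Tmult g h (v, w) - Tmult g h (v, 0)"
       "Tmult g h (0, w') = Tmult g h (v, w') - Tmult g h (v, 0)"
    by (simp_all flip: blinfun.diff_right)
  then show ?thesis using *[of w] *[of w'] eq by simp
qed

text \<open>The derivatives of the constant maps y \<mapsto> y y^-1 and y \<mapsto> y^-1 y, computed
  by the chain rule.\<close>

lemma Tmult_Tinv:
  assumes g: "g \<in> carrier G"
  shows "Tmult g (inv\<^bsub>G\<^esub> g) (v, Tinv g v) = 0" "Tmult (inv\<^bsub>G\<^esub> g) g (Tinv g v, v) = 0"
proof -
  interpret group G by (rule group)
  have i: "inv\<^bsub>G\<^esub> g \<in> carrier G" using g by auto
  note cg = chart_at_carrier[OF g] and cc = smooth_manifold_coordinate_chart[OF manifold]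
  note id = chart_deriv_ident[OF cc[OF cg(1)] cg(2)]
  note const = chart_deriv_const[OF cc[OF cg(1)] cg(2) coordinate_unit_chart one_in_unit_chart]
  have "chart_deriv (chart_at M g) unit_chart (\<lambda>y. y \<otimes>\<^bsub>G\<^esub> inv\<^bsub>G\<^esub> y) g (\<lambda>v. Tmult g (inv\<^bsub>G\<^esub> g) (v, Tinv g v))"
    using chart_deriv_compose[OF chart_deriv_Pair[OF id chart_deriv_Tinv[OF g]] chart_deriv_Tmult[OF g i]] g by simp
  then have "chart_deriv (chart_at M g) unit_chart (\<lambda>y. \<one>\<^bsub>G\<^esub>) g (\<lambda>v. Tmult g (inv\<^bsub>G\<^esub> g) (v, Tinv g v))"
    by (rule chart_deriv_cong) (use in_carrier[OF cg(1)] in simp)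
  from fun_cong[OF chart_deriv_unique[OF this const]] show "Tmult g (inv\<^bsub>G\<^esub> g) (v, Tinv g v) = 0" .
  have "chart_deriv (chart_at M g) unit_chart (\<lambda>y. inv\<^bsub>G\<^esub> y \<otimes>\<^bsub>G\<^esub> y) g (\<lambda>v. Tmult (inv\<^bsub>G\<^esub> g) g (Tinv g v, v))"
    using chart_deriv_compose[OF chart_deriv_Pair[OF chart_deriv_Tinv[OF g] id] chart_deriv_Tmult[OF i g]] g by simp
  then have "chart_deriv (chart_at M g) unit_chart (\<lambda>y. \<one>\<^bsub>G\<^esub>) g (\<lambda>v. Tmult (inv\<^bsub>G\<^esub> g) g (Tinv g v, v))"
    by (rule chart_deriv_cong) (use in_carrier[OF cg(1)] in simp)
  from fun_cong[OF chart_deriv_unique[OF this const]] show "Tmult (inv\<^bsub>G\<^esub> g) g (Tinv g v, v) = 0" .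
qed

section \<open>The tangent group and its inverses\<close>

lemma tangent_group_simps:
  "\<one>\<^bsub>tangent_group G M\<^esub> = (\<one>\<^bsub>G\<^esub>, 0)"
  "(g, v) \<otimes>\<^bsub>tangent_group G M\<^esub> (h, w) = (g \<otimes>\<^bsub>G\<^esub> h, Tmult g h (v, w))"
  "carrier (tangent_group G M) = carrier G \<times> UNIV"
  by (simp_all add: tangent_group_def tangent_bundle_def carrier)

text \<open>Injectivity of left translations gives the uniqueness needed for the description operator in
  \<^const>\<open>m_inv\<close>, so the tangent group need not be shown to be a group.\<close>

lemma tangent_group_inv:
  assumes g: "g \<in> carrier G"
  shows "inv\<^bsub>tangent_group G M\<^esub> (g, v) = (inv\<^bsub>G\<^esub> g, Tinv g v)"
  unfolding m_inv_def[of "tangent_group G M"]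
proof (rule the_equality)
  interpret group G by (rule group)
  show "(inv\<^bsub>G\<^esub> g, Tinv g v) \<in> carrier (tangent_group G M) \<and>
    (g, v) \<otimes>\<^bsub>tangent_group G M\<^esub> (inv\<^bsub>G\<^esub> g, Tinv g v) = \<one>\<^bsub>tangent_group G M\<^esub> \<and>
    (inv\<^bsub>G\<^esub> g, Tinv g v) \<otimes>\<^bsub>tangent_group G M\<^esub> (g, v) = \<one>\<^bsub>tangent_group G M\<^esub>"
    using g Tmult_Tinv[OF g] by (simp add: tangent_group_simps)
  fix z assume z: "z \<in> carrier (tangent_group G M) \<and>
    (g, v) \<otimes>\<^bsub>tangent_group G M\<^esub> z = \<one>\<^bsub>tangent_group G M\<^esub> \<and> z \<otimes>\<^bsub>tangent_group G M\<^esub> (g, v) = \<one>\<^bsub>tangent_group G M\<^esub>"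
  obtain h w where hw: "z = (h, w)" by fastforce
  have h: "h \<in> carrier G" "g \<otimes>\<^bsub>G\<^esub> h = \<one>\<^bsub>G\<^esub>" "h \<otimes>\<^bsub>G\<^esub> g = \<one>\<^bsub>G\<^esub>" "Tmult g h (v, w) = 0"
    using z by (auto simp: hw tangent_group_simps)
  then have "h = inv\<^bsub>G\<^esub> g" using g by (metis inv_equality)
  with h show "z = (inv\<^bsub>G\<^esub> g, Tinv g v)"
    using Tmult_left_cancel[OF g h(1), of v w "Tinv g v"] Tmult_Tinv(1)[OF g, of v] by (simp add: hw)
qed

section \<open>Translations near the unit\<close>

lemma mult_expr_unit:
  assumes "x \<in> chart_image unit_chart"
  shows "mult_expr (x, unit_coords) = x" "mult_expr (unit_coords, x) = x"
proof -
  interpret group G by (rule group)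
  have "chart_inv unit_chart x \<in> carrier G"
    using in_carrier[OF unit_chart_atlas chart_inv_in[OF assms]] .
  then show "mult_expr (x, unit_coords) = x" "mult_expr (unit_coords, x) = x"
    using mult_expr_apply[OF chart_inv_in[OF assms] one_in_unit_chart]
      mult_expr_apply[OF one_in_unit_chart chart_inv_in[OF assms]] by (simp_all add: chart_apply_inv[OF assms])
qed

lemma unit_coords_mem:
  "unit_coords \<in> chart_image unit_chart" "unit_coords \<in> inv_dom" "(unit_coords, unit_coords) \<in> mult_dom"
  "inv_expr unit_coords = unit_coords"
proof -
  interpret group G by (rule group)
  show "unit_coords \<in> chart_image unit_chart" by (rule chart_image_apply[OF one_in_unit_chart])
  show "unit_coords \<in> inv_dom" unfolding inv_dom_def using one_in_unit_chart by auto
  show "(unit_coords, unit_coords) \<in> mult_dom" using in_mult_dom one_in_unit_chart by simp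
  show "inv_expr unit_coords = unit_coords" using inv_expr_apply[OF one_in_unit_chart] by simp
qed

text \<open>Multiplication by the unit is the identity in either slot, so both partial derivatives
  at the unit are identities.\<close>

lemma frechet_derivative_mult_expr_unit:
  "frechet_derivative mult_expr (at (unit_coords, unit_coords)) (a, 0) = a"
  "frechet_derivative mult_expr (at (unit_coords, unit_coords)) (0, a) = a"
proof -
  have id: "(f has_derivative (\<lambda>a. a)) (at unit_coords)" if "\<And>x. x \<in> chart_image unit_chart \<Longrightarrow> f x = x" for f
    by (rule has_derivative_transform_within_open[OF has_derivative_ident _ unit_coords_mem(1)])
       (use coordinate_unit_chart that in \<open>auto simp: coordinate_chart_def\<close>)
  note d = smooth_on_has_derivative[OF smooth_mult_expr unit_coords_mem(3)]
  have "((\<lambda>x. (x, unit_coords)) has_derivative (\<lambda>a. (a, 0))) (at unit_coords)"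
    by (auto intro!: derivative_eq_intros)
  from has_derivative_compose[OF this d] fun_cong[OF has_derivative_unique[OF _ id]]
  show "frechet_derivative mult_expr (at (unit_coords, unit_coords)) (a, 0) = a"
    using mult_expr_unit(1) by blast
  have "((\<lambda>x. (unit_coords, x)) has_derivative (\<lambda>a. (0, a))) (at unit_coords)"
    by (auto intro!: derivative_eq_intros)
  from has_derivative_compose[OF this d] fun_cong[OF has_derivative_unique[OF _ id]]
  show "frechet_derivative mult_expr (at (unit_coords, unit_coords)) (0, a) = a"
    using mult_expr_unit(2) by blast
qed

text \<open>The product of g and its inverse is the unit, which lies in the unit chart; this places
  (x, inv x) in the domain of the coordinate multiplication for every x in
  \<open>inv_dom\<close>.\<close>

lemma inv_dom_chart_inv:
  assumes "x \<in> inv_dom"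
  defines "g \<equiv> chart_inv unit_chart x"
  shows "g \<in> fst unit_chart" "inv\<^bsub>G\<^esub> g \<in> fst unit_chart" "snd unit_chart g = x"
    "g \<otimes>\<^bsub>G\<^esub> inv\<^bsub>G\<^esub> g = \<one>\<^bsub>G\<^esub>" "g \<in> carrier G" "inv\<^bsub>G\<^esub> g \<in> carrier G"
    "snd unit_chart (inv\<^bsub>G\<^esub> g) = inv_expr x" "(x, inv_expr x) \<in> mult_dom"
proof -
  interpret group G by (rule group)
  obtain h where h: "h \<in> fst unit_chart" "inv\<^bsub>G\<^esub> h \<in> fst unit_chart" "x = snd unit_chart h"
    using assms(1) by (auto simp: inv_dom_def)
  have gh: "g = h" unfolding g_def h(3) by (rule chart_inv_apply[OF coordinate_unit_chart h(1)])
  have hc: "h \<in> carrier G" by (rule in_carrier[OF unit_chart_atlas h(1)])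
  show "g \<in> fst unit_chart" "inv\<^bsub>G\<^esub> g \<in> fst unit_chart" "snd unit_chart g = x"
    "g \<otimes>\<^bsub>G\<^esub> inv\<^bsub>G\<^esub> g = \<one>\<^bsub>G\<^esub>" "g \<in> carrier G" "inv\<^bsub>G\<^esub> g \<in> carrier G"
    "snd unit_chart (inv\<^bsub>G\<^esub> g) = inv_expr x"
    using h hc inv_expr_apply[OF h(1)] by (auto simp: gh)
  show "(x, inv_expr x) \<in> mult_dom"
    using in_mult_dom[OF h(1,2)] hc h(3) inv_expr_apply[OF h(1)] one_in_unit_chart by simp
qed

lemma components_Tinv:
  assumes "g \<in> fst unit_chart" "inv\<^bsub>G\<^esub> g \<in> fst unit_chart"
  shows "components M unit_chart (inv\<^bsub>G\<^esub> g) (Tinv g v)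
    = frechet_derivative inv_expr (at (snd unit_chart g)) (components M unit_chart g v)"
  unfolding inv_expr_def
  by (rule components_tangent_map_at(1)[OF manifold
        chart_deriv_smooth_map[OF manifold manifold smooth_inv unit_chart_atlas unit_chart_atlas assms]
        chart_deriv_components[OF manifold unit_chart_atlas assms(1)] unit_chart_atlas assms(2)])

lemma chart_deriv_right_translation:
  assumes "g \<in> fst unit_chart" "k \<in> fst unit_chart" "g \<otimes>\<^bsub>G\<^esub> k \<in> fst unit_chart"
  shows "chart_deriv unit_chart unit_chart (\<lambda>h. h \<otimes>\<^bsub>G\<^esub> k) g
    (\<lambda>a. frechet_derivative mult_expr (at (snd unit_chart g, snd unit_chart k)) (a, 0))"
  using chart_deriv_compose[OF chart_deriv_Pair[OF chart_deriv_ident chart_deriv_const] chart_deriv_unit_mult[OF assms]]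
    coordinate_unit_chart assms by simp

text \<open>Right translation by (k, s) is the tangent map of the multiplication with the second
  factor frozen at (y, r). Only the first factor is varied, hence the zeros in the increments; the
  second derivative is taken along the full velocity (v, r).\<close>

lemma chart_deriv_tangent_right_translation:
  fixes g k :: 'p and u s :: 'e
  assumes gk: "g \<in> fst unit_chart" "k \<in> fst unit_chart" "g \<otimes>\<^bsub>G\<^esub> k \<in> fst unit_chart"
  defines "x \<equiv> snd unit_chart g" and "y \<equiv> snd unit_chart k"
    and "v \<equiv> components M unit_chart g u" and "r \<equiv> components M unit_chart k s"
  shows "chart_deriv (tangent_chart M unit_chart) (tangent_chart M unit_chart) (\<lambda>z. z \<otimes>\<^bsub>tangent_group G M\<^esub> (k, s)) (g, u)
    (\<lambda>w. (frechet_derivative mult_expr (at (x, y)) (fst w, 0),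
       second_derivative mult_expr (x, y) (v, r) (fst w, 0) + frechet_derivative mult_expr (at (x, y)) (snd w, 0)))"
proof (rule chart_derivI[where F = "\<lambda>z. tangent_fun mult_expr ((fst z, y), (snd z, r))"])
  define S where "S = (\<lambda>x. (x, y)) -` mult_dom"
  have "open S" unfolding S_def by (intro open_vimage open_mult_dom continuous_intros)
  then show "open (S \<times> (UNIV::'e set))" by (simp add: open_Times)
  have xy: "(x, y) \<in> mult_dom" unfolding x_def y_def by (rule in_mult_dom[OF gk])
  show "snd (tangent_chart M unit_chart) (g, u) \<in> S \<times> (UNIV::'e set)"
    using xy by (simp add: S_def tangent_chart_def x_def)
  have 1: "((\<lambda>z::'e\<times>'e. ((fst z, y), (snd z, r))) has_derivative (\<lambda>w. ((fst w, 0), (snd w, 0)))) (at (x, v))"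
    by (auto intro!: derivative_eq_intros)
  have 2: "(tangent_fun mult_expr has_derivative (\<lambda>w. (frechet_derivative mult_expr (at (x, y)) (fst w),
      second_derivative mult_expr (x, y) (v, r) (fst w) + frechet_derivative mult_expr (at (x, y)) (snd w))))
      (at ((fst (x, v), y), (snd (x, v), r)))"
    using tangent_fun_has_derivative[OF open_mult_dom xy smooth_mult_expr, of "(v, r)"] by simp
  show "((\<lambda>z. tangent_fun mult_expr ((fst z, y), (snd z, r))) has_derivative
    (\<lambda>w. (frechet_derivative mult_expr (at (x, y)) (fst w, 0),
       second_derivative mult_expr (x, y) (v, r) (fst w, 0) + frechet_derivative mult_expr (at (x, y)) (snd w, 0))))
      (at (snd (tangent_chart M unit_chart) (g, u)))"
    using has_derivative_compose[OF 1 2] by (simp add: tangent_chart_def x_def v_def)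
  fix z assume z: "z \<in> fst (tangent_chart M unit_chart)" "snd (tangent_chart M unit_chart) z \<in> S \<times> (UNIV::'e set)"
  obtain h w where hw: "z = (h, w)" by fastforce
  have h: "h \<in> fst unit_chart" "(snd unit_chart h, snd unit_chart k) \<in> mult_dom"
    using z by (auto simp: hw tangent_chart_def S_def y_def)
  have hk: "h \<otimes>\<^bsub>G\<^esub> k \<in> fst unit_chart" by (rule mult_domD[OF h(2,1) gk(2)])
  show "z \<otimes>\<^bsub>tangent_group G M\<^esub> (k, s) \<in> fst (tangent_chart M unit_chart) \<and>
    snd (tangent_chart M unit_chart) (z \<otimes>\<^bsub>tangent_group G M\<^esub> (k, s))
     = tangent_fun mult_expr ((fst (snd (tangent_chart M unit_chart) z), y), (snd (snd (tangent_chart M unit_chart) z), r))"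
    using hk components_Tmult[OF h(1) gk(2) hk, of w s] mult_expr_apply[OF h(1) gk(2)]
    by (simp add: hw tangent_group_simps tangent_chart_def tangent_fun_def y_def r_def)
qed (use gk coordinate_chart_tangent(1)[OF manifold unit_chart_atlas] in \<open>simp_all add: tangent_chart_def\<close>)

end

section \<open>Cobrackets\<close>

text \<open>The right factor is exactly the map that brings a bivector at \<open>p\<close> into the
  chart \<open>c\<close>. Hence a right trivialisation becomes \<open>wedge_map\<close> of a
  coordinate derivative applied to the local form.\<close>

lemma tangent_map_at_factor:
  assumes "chart_deriv c d R p A" "chart_deriv (chart_at N p) c (\<lambda>q. q) p (blinfun_apply (components N c p))"
    and "chart_at N (R p) = d"
  shows "tangent_map_at N N R p = Blinfun A o\<^sub>L components N c p"
proof (rule blinfun_eqI)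
  have "chart_deriv (chart_at N p) (chart_at N (R p)) R p (\<lambda>v. A (components N c p v))"
    using chart_deriv_compose[OF assms(2,1)] by (simp add: assms(3))
  from tangent_map_at_eqI[OF this]
  show "tangent_map_at N N R p v = (Blinfun A o\<^sub>L components N c p) v" for v
    by (simp add: bounded_linear_Blinfun_apply[OF chart_deriv_bounded_linear[OF assms(1)]])
qed

lemma chart_deriv_tangent_components:
  assumes "smooth_manifold M" "c \<in> atlas M" "p \<in> fst c"
  shows "chart_deriv (chart_at (tangent_bundle M) (p, u)) (tangent_chart M c) (\<lambda>z. z) (p, u)
    (blinfun_apply (components (tangent_bundle M) (tangent_chart M c) (p, u)))"
proof -
  have p: "p \<in> points M" using smooth_manifold_chart_subset[OF assms] .
  have eq: "chart_at (tangent_bundle M) (p, u) = tangent_chart M (chart_at M p)"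
    by (simp add: tangent_bundle_def)
  note d = chart_deriv_tangent_transition[OF assms(1) smooth_manifold_chart_at(1)[OF assms(1) p] assms(2)
      smooth_manifold_chart_at(2)[OF assms(1) p] assms(3), of u, folded eq]
  from d components_eqI[OF d] show ?thesis by simp
qed

context smooth_group
begin

lemma right_trivialisation_in_chart:
  assumes x: "x \<in> inv_dom"
  shows "right_trivialisation G M \<Lambda> (chart_inv unit_chart x)
    = wedge_map (Blinfun (\<lambda>a. frechet_derivative mult_expr (at (x, inv_expr x)) (a, 0))) (bivec_in_chart M \<Lambda> unit_chart x)"
proof -
  define g where "g = chart_inv unit_chart x"
  note g = inv_dom_chart_inv[OF x, folded g_def]
  have "tangent_map_at M M (\<lambda>h. h \<otimes>\<^bsub>G\<^esub> inv\<^bsub>G\<^esub> g) g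
      = Blinfun (\<lambda>a. frechet_derivative mult_expr (at (x, inv_expr x)) (a, 0)) o\<^sub>L components M unit_chart g"
    using tangent_map_at_factor[OF chart_deriv_right_translation[OF g(1,2)] chart_deriv_components[OF manifold unit_chart_atlas g(1)]]
      g one_in_unit_chart by simp
  then show ?thesis
    unfolding right_trivialisation_def bivec_in_chart_def g_def[symmetric] by (simp add: wedge_map_compose)
qed

text \<open>The derivative of right translation in the tangent group, specialised to the inverse of
  the element with coordinates \<open>z\<close>; the velocity of that inverse is the derivative of
  inversion applied to \<open>snd z\<close>.\<close>

definition right_translation_deriv :: "'e \<times> 'e \<Rightarrow> 'e \<times> 'e \<Rightarrow> 'e \<times> 'e" where
  "right_translation_deriv z w =
     (frechet_derivative mult_expr (at (fst z, inv_expr (fst z))) (fst w, 0),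
      second_derivative mult_expr (fst z, inv_expr (fst z)) (snd z, frechet_derivative inv_expr (at (fst z)) (snd z)) (fst w, 0)
      + frechet_derivative mult_expr (at (fst z, inv_expr (fst z))) (snd w, 0))"

lemma right_trivialisation_tangent_in_chart:
  assumes x: "fst z \<in> inv_dom"
  defines "tc \<equiv> tangent_chart M unit_chart"
  shows "right_trivialisation (tangent_group G M) (tangent_bundle M) \<Theta> (chart_inv tc z)
    = wedge_map (Blinfun (right_translation_deriv z)) (bivec_in_chart (tangent_bundle M) \<Theta> tc z)"
    and "bounded_linear (right_translation_deriv z)"
proof -
  obtain g u where gu: "chart_inv tc z = (g, u)" by fastforce
  have "fst z \<in> chart_image unit_chart" using x by (auto simp: inv_dom_def chart_image_def)
  then have z: "z \<in> chart_image tc"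
    unfolding tc_def coordinate_chart_tangent(2)[OF manifold unit_chart_atlas] by (cases z) simp
  have "(g, u) \<in> fst tc" "snd tc (g, u) = z"
    using chart_inv_in[OF z] chart_apply_inv[OF z] by (simp_all add: gu)
  then have gz: "g \<in> fst unit_chart" "z = (snd unit_chart g, components M unit_chart g u)"
    by (auto simp: tc_def tangent_chart_def)
  have geq: "chart_inv unit_chart (fst z) = g"
    by (simp add: gz(2) chart_inv_apply[OF coordinate_unit_chart gz(1)])
  note g = inv_dom_chart_inv[OF x, unfolded geq]
  have inv: "inv\<^bsub>tangent_group G M\<^esub> (g, u) = (inv\<^bsub>G\<^esub> g, Tinv g u)"
    by (rule tangent_group_inv[OF g(5)])
  let ?R = "\<lambda>h. h \<otimes>\<^bsub>tangent_group G M\<^esub> inv\<^bsub>tangent_group G M\<^esub> (g, u)"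
  have gi: "g \<otimes>\<^bsub>G\<^esub> inv\<^bsub>G\<^esub> g \<in> fst unit_chart" using g(4) one_in_unit_chart by simp
  have d: "chart_deriv tc tc ?R (g, u) (right_translation_deriv z)"
    using chart_deriv_tangent_right_translation[OF g(1,2) gi, where u = u and s = "Tinv g u"]
    unfolding inv right_translation_deriv_def[abs_def] components_Tinv[OF g(1,2)] g(7) tc_def
    unfolding gz(2) fst_conv snd_conv .
  show "bounded_linear (right_translation_deriv z)" by (rule chart_deriv_bounded_linear[OF d])
  \<comment> \<open>The translated point is the unit of the tangent group, so the preferred chart at
    the target is \<open>tc\<close> whatever the preferred chart at (g, u) is.\<close>
  have "?R (g, u) = (\<one>\<^bsub>G\<^esub>, 0)"
    unfolding inv by (simp add: tangent_group_simps g(4) Tmult_Tinv(1)[OF g(5)])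
  then have c: "chart_at (tangent_bundle M) (?R (g, u)) = tc"
    by (simp add: tangent_bundle_def tc_def)
  have "tangent_map_at (tangent_bundle M) (tangent_bundle M) ?R (g, u)
      = Blinfun (right_translation_deriv z) o\<^sub>L components (tangent_bundle M) tc (g, u)"
    by (rule tangent_map_at_factor[OF d _ c])
       (simp add: tc_def chart_deriv_tangent_components[OF manifold unit_chart_atlas g(1)])
  then show "right_trivialisation (tangent_group G M) (tangent_bundle M) \<Theta> (chart_inv tc z)
    = wedge_map (Blinfun (right_translation_deriv z)) (bivec_in_chart (tangent_bundle M) \<Theta> tc z)"
    unfolding right_trivialisation_def bivec_in_chart_def gu by (simp add: wedge_map_compose)
qed

section \<open>Limits of the translation derivatives at the unit\<close>

lemma isCont_pair_inv_expr: "isCont (\<lambda>x. (x, inv_expr x)) unit_coords"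
proof -
  have "isCont inv_expr unit_coords"
    using has_derivative_continuous[OF smooth_on_has_derivative[OF smooth_inv_expr unit_coords_mem(2)]] .
  then show ?thesis by (intro continuous_intros)
qed

lemma isCont_mult_dom:
  assumes "smooth_on mult_dom f"
  shows "isCont (\<lambda>x. f (x, inv_expr x)) unit_coords"
proof (rule isCont_o2[OF isCont_pair_inv_expr])
  show "isCont f (unit_coords, inv_expr unit_coords)"
    unfolding unit_coords_mem(4)
    using smooth_on_imp_continuous_on[OF assms] open_mult_dom unit_coords_mem(3)
    by (simp add: continuous_on_eq_continuous_at)
qed

lemma tendsto_right_translation:
  "((\<lambda>x. frechet_derivative mult_expr (at (x, inv_expr x)) (a, 0)) \<longlongrightarrow> a) (at unit_coords)"
  using isCont_mult_dom[OF smooth_on_frechet_derivative[OF smooth_mult_expr, of "(a, 0)"]]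
  by (simp add: isCont_def unit_coords_mem(4) frechet_derivative_mult_expr_unit)

text \<open>The diagonal blocks converge as for \<open>G\<close> itself. In the off-diagonal block
  the first direction is the velocity paired with its image under the derivative of inversion; it
  tends to 0 with the velocity and takes the block with it.\<close>

lemma tendsto_right_translation_deriv:
  "((\<lambda>z. right_translation_deriv z w) \<longlongrightarrow> w) (at (unit_coords, 0))"
proof -
  have fst: "isCont fst (unit_coords, 0::'e)" by (intro continuous_intros)
  have D: "((\<lambda>z. frechet_derivative mult_expr (at (fst z, inv_expr (fst z))) (a, 0)) \<longlongrightarrow> a) (at (unit_coords, 0::'e))" for a
  proof -
    have "isCont (\<lambda>z. frechet_derivative mult_expr (at (fst z, inv_expr (fst z))) (a, 0)) (unit_coords, 0::'e)"
      by (rule isCont_o2[OF fst]) (simp add: isCont_mult_dom[OF smooth_on_frechet_derivative[OF smooth_mult_expr]])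
    then show ?thesis by (simp add: isCont_def unit_coords_mem(4) frechet_derivative_mult_expr_unit)
  qed
  have D2: "((\<lambda>z. second_derivative mult_expr (fst z, inv_expr (fst z)) b (a, 0))
      \<longlongrightarrow> second_derivative mult_expr (unit_coords, unit_coords) b (a, 0)) (at (unit_coords, 0::'e))" for a b
  proof -
    have "isCont (\<lambda>z. second_derivative mult_expr (fst z, inv_expr (fst z)) b (a, 0)) (unit_coords, 0::'e)"
      unfolding second_derivative_def
      by (rule isCont_o2[OF fst])
         (simp add: isCont_mult_dom[OF smooth_on_frechet_derivative[OF smooth_on_frechet_derivative[OF smooth_mult_expr]]])
    then show ?thesis by (simp add: isCont_def unit_coords_mem(4))
  qed
  have inv0: "frechet_derivative inv_expr (at unit_coords) 0 = 0"
    using has_derivative_linear[OF smooth_on_has_derivative[OF smooth_inv_expr unit_coords_mem(2)]] by (rule linear_0)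
  have I: "((\<lambda>z. frechet_derivative inv_expr (at (fst z)) (snd z)) \<longlongrightarrow> 0) (at (unit_coords, 0))"
    using has_derivative_continuous[OF frechet_derivative_has_derivative[OF open_inv_dom unit_coords_mem(2) smooth_inv_expr, of 0]]
    by (simp add: isCont_def inv0)
  have S: "((\<lambda>z::'e\<times>'e. snd z) \<longlongrightarrow> 0) (at (unit_coords, 0))"
    using tendsto_snd[OF tendsto_ident_at] by (metis snd_conv)
  \<comment> \<open>The direction depends on z, while continuity is known for fixed directions only;
    the expansion in \<open>Basis\<close> separates vanishing coefficients from convergent second
    derivatives.\<close>
  have "((\<lambda>z. \<Sum>b\<in>Basis. ((snd z, frechet_derivative inv_expr (at (fst z)) (snd z)) \<bullet> b) *\<^sub>R
        second_derivative mult_expr (fst z, inv_expr (fst z)) b (a, 0))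
     \<longlongrightarrow> (\<Sum>b\<in>Basis. ((0::'e, 0::'e) \<bullet> b) *\<^sub>R second_derivative mult_expr (unit_coords, unit_coords) b (a, 0)))
     (at (unit_coords, 0))" for a
    by (intro tendsto_sum tendsto_scaleR tendsto_inner tendsto_Pair S I D2 tendsto_const)
  then have lim: "((\<lambda>z. \<Sum>b\<in>Basis. ((snd z, frechet_derivative inv_expr (at (fst z)) (snd z)) \<bullet> b) *\<^sub>R
        second_derivative mult_expr (fst z, inv_expr (fst z)) b (a, 0)) \<longlongrightarrow> 0) (at (unit_coords, 0))" for a
    by (simp add: zero_prod_def[symmetric])
  have open_dom: "open (inv_dom \<times> (UNIV::'e set))" by (simp add: open_Times open_inv_dom)
  have L: "((\<lambda>z. second_derivative mult_expr (fst z, inv_expr (fst z))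
      (snd z, frechet_derivative inv_expr (at (fst z)) (snd z)) (a, 0)) \<longlongrightarrow> 0) (at (unit_coords, 0))" for a
  proof (rule Lim_transform_within_open[OF lim open_dom])
    fix z assume "z \<in> inv_dom \<times> (UNIV::'e set)"
    then have "(fst z, inv_expr (fst z)) \<in> mult_dom" using inv_dom_chart_inv(8) by auto
    then show "(\<Sum>b\<in>Basis. ((snd z, frechet_derivative inv_expr (at (fst z)) (snd z)) \<bullet> b) *\<^sub>R
        second_derivative mult_expr (fst z, inv_expr (fst z)) b (a, 0))
      = second_derivative mult_expr (fst z, inv_expr (fst z)) (snd z, frechet_derivative inv_expr (at (fst z)) (snd z)) (a, 0)"
      by (rule second_derivative_basis_expansion[OF open_mult_dom _ smooth_mult_expr, symmetric])
  qed (simp add: unit_coords_mem(2))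
  have "((\<lambda>z. right_translation_deriv z w) \<longlongrightarrow> (fst w, 0 + snd w)) (at (unit_coords, 0))"
    unfolding right_translation_deriv_def by (intro tendsto_Pair tendsto_add D L)
  then show ?thesis by simp
qed

text \<open>The preferred chart of the tangent bundle at (1, 0) is induced by the unit chart. In it
  the zero section reads x \<mapsto> (x, 0) and the fibre inclusion v \<mapsto> (x0, v), so the
  identification is invisible in coordinates.\<close>

lemma tangent_lie_algebra_iso_id: "tangent_lie_algebra_iso G M = (\<lambda>z. z)"
proof
  fix z :: "'e \<times> 'e"
  obtain X Y where z: "z = (X, Y)" by fastforce
  let ?tc = "tangent_chart M unit_chart"
  have c: "coordinate_chart ?tc" using coordinate_chart_tangent(1)[OF manifold unit_chart_atlas] .
  have "chart_deriv unit_chart ?tc (\<lambda>g. (g, 0)) \<one>\<^bsub>G\<^esub> (\<lambda>X. (X, 0))"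
    by (rule chart_derivI[OF coordinate_unit_chart c one_in_unit_chart, of UNIV _ "\<lambda>x. (x, 0)"])
       (auto simp: tangent_chart_def intro!: derivative_eq_intros)
  then have 1: "blinfun_apply (tangent_map_at M (tangent_bundle M) (\<lambda>g. (g, 0)) \<one>\<^bsub>G\<^esub>) = (\<lambda>X. (X, 0))"
    by (intro tangent_map_at_eqI) (simp add: tangent_bundle_def)
  have "chart_deriv (UNIV, id) ?tc (\<lambda>v. (\<one>\<^bsub>G\<^esub>, v)) 0 (\<lambda>Y. (0, Y))"
    by (rule chart_derivI[OF _ c, of _ _ UNIV _ "\<lambda>v. (unit_coords, v)"])
       (auto simp: tangent_chart_def coordinate_chart_def chart_image_def one_in_unit_chart
          components_chart_at[OF manifold one_point] intro!: derivative_eq_intros)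
  then have 2: "blinfun_apply (tangent_map_at vector_space_manifold (tangent_bundle M) (\<lambda>v. (\<one>\<^bsub>G\<^esub>, v)) 0) = (\<lambda>Y. (0, Y))"
    by (intro tangent_map_at_eqI) (simp add: tangent_bundle_def vector_space_manifold_def)
  show "tangent_lie_algebra_iso G M z = z"
    unfolding tangent_lie_algebra_iso_def z case_prod_conv 1 2 by simp
qed

end

section \<open>The linear bivector field on the Lie algebra and the dual bracket\<close>

lemma bivec_in_chart_vector_space:
  "bivec_in_chart vector_space_manifold \<delta> (UNIV, id) = (\<delta> :: 'e::euclidean_space \<Rightarrow> 'e bivec)"
proof
  fix x :: 'e
  have c: "coordinate_chart (UNIV, id :: 'e \<Rightarrow> 'e)" by (simp add: coordinate_chart_def chart_image_def)
  have "chart_deriv (chart_at vector_space_manifold x) (UNIV, id) (\<lambda>q. q) x (\<lambda>v. v)"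
    using chart_deriv_ident[OF c, of x] by (simp add: vector_space_manifold_def)
  from components_eqI[OF this] have "components vector_space_manifold (UNIV, id) x = id_blinfun"
    by (intro blinfun_eqI) simp
  moreover have "chart_inv (UNIV, id) x = x" using chart_inv_apply[OF c, of x] by simp
  ultimately show "bivec_in_chart vector_space_manifold \<delta> (UNIV, id) x = \<delta> x"
    by (simp add: bivec_in_chart_def wedge_map_id)
qed

lemma lift_in_chart_linear:
  assumes "\<And>\<xi> \<eta>. bounded_linear (\<lambda>X. \<delta> X \<xi> \<eta>)"
  shows "lift_in_chart \<delta> z \<xi> \<eta> = \<delta> (fst z) (base_part \<xi>) (fibre_part \<eta>)
    + \<delta> (fst z) (fibre_part \<xi>) (base_part \<eta>) + \<delta> (snd z) (fibre_part \<xi>) (fibre_part \<eta>)"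
  using frechet_derivative_at[OF bounded_linear_imp_has_derivative[OF assms], symmetric]
  by (simp add: lift_in_chart_def)

lemma tangent_lift_vector_space:
  fixes \<delta> :: "'e::euclidean_space \<Rightarrow> 'e bivec"
  assumes "\<And>X. bivector (\<delta> X)" and lin: "\<And>\<xi> \<eta>. bounded_linear (\<lambda>X. \<delta> X \<xi> \<eta>)"
  shows "tangent_lift vector_space_manifold \<delta> = lift_in_chart \<delta>"
proof
  fix z :: "'e \<times> 'e"
  obtain X Y where z: "z = (X, Y)" by fastforce
  have c: "chart_at vector_space_manifold X = (UNIV, id)" by (simp add: vector_space_manifold_def)
  have "(\<lambda>X. \<delta> X \<xi> \<eta>) differentiable (at X)" for \<xi> \<eta>
    using bounded_linear_imp_has_derivative[OF lin] by (auto simp: differentiable_def)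
  then show "tangent_lift vector_space_manifold \<delta> z = lift_in_chart \<delta> z"
    using tangent_lift_eq_lift_in_chart[of UNIV vector_space_manifold X \<delta> Y] assms(1)
    by (simp add: c bivec_in_chart_vector_space z)
qed

lemma tangent_dual_iso_apply:
  "blinfun_apply (tangent_dual_iso (a, b)) z = b (fst z) + a (snd z)"
proof -
  have "bounded_linear (\<lambda>z. blinfun_apply b (fst z) + blinfun_apply a (snd z))"
    by (intro bounded_linear_add bounded_linear_compose[OF blinfun.bounded_linear_right]
        bounded_linear_fst bounded_linear_snd)
  from bounded_linear_Blinfun_apply[OF this] show ?thesis
    by (simp add: tangent_dual_iso_def case_prod_unfold)
qed

text \<open>The pairing is the tangent of the canonical one, hence crossed: the base component of a
  dual pair acts on velocities and its tangent component on base points.\<close>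

lemma base_part_tangent_dual_iso: "base_part (tangent_dual_iso (a, b)) = b"
  and fibre_part_tangent_dual_iso: "fibre_part (tangent_dual_iso (a, b)) = a"
  by (rule blinfun_eqI, simp add: tangent_dual_iso_apply)+

text \<open>For (a, b) and (a', b') the lift at (X, Y) is \<delta> X (b, a') + \<delta> X (a, b') +
  \<delta> Y (a, a'). The first two terms pair [b, a'] + [a, b'] with X and the last pairs [a, a']
  with Y, which is the crossed pairing with the tangent bracket.\<close>

lemma dual_bracket_lift_in_chart:
  assumes lin: "\<And>\<xi> \<eta>. bounded_linear (\<lambda>X. \<delta> X \<xi> \<eta>)"
  shows "dual_bracket (lift_in_chart \<delta>) (tangent_dual_iso \<alpha>) (tangent_dual_iso \<beta>)
        = tangent_dual_iso (tangent_bracket (dual_bracket \<delta>) \<alpha> \<beta>)"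
proof -
  obtain a b a' b' where ab: "\<alpha> = (a, b)" "\<beta> = (a', b')" by fastforce
  have br: "blinfun_apply (dual_bracket \<delta> \<xi> \<eta>) X = \<delta> X \<xi> \<eta>" for \<xi> \<eta> X
    by (simp add: dual_bracket_def bounded_linear_Blinfun_apply[OF lin])
  have iso: "tangent_dual_iso (p, q) = Blinfun (\<lambda>z. q (fst z) + p (snd z))" for p q :: "'a dual"
    by (simp add: tangent_dual_iso_def case_prod_unfold)
  show ?thesis
    unfolding ab tangent_bracket_def case_prod_conv
    unfolding iso[of "dual_bracket \<delta> a a'"] dual_bracket_def[of "lift_in_chart \<delta>"]
    by (rule arg_cong[of _ _ Blinfun])
       (simp add: fun_eq_iff lift_in_chart_linear[OF lin] base_part_tangent_dual_iso
          fibre_part_tangent_dual_iso blinfun.add_left br)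
qed

section \<open>Cobrackets of Poisson-Lie groups\<close>

locale poisson_group =
  fixes G :: "'p monoid" and M :: "('p, 'e::euclidean_space) manifold" and \<Lambda> :: "'p \<Rightarrow> 'e bivec"
  assumes poisson_lie_group: "poisson_lie_group G M \<Lambda>"

sublocale poisson_group \<subseteq> smooth_group
  by unfold_locales (use poisson_lie_group in \<open>simp add: poisson_lie_group_def\<close>)

context poisson_group
begin

lemma bivector_field: "bivector_field M \<Lambda>"
  using poisson_lie_group by (simp add: poisson_lie_group_def poisson_structure_def)

abbreviation local_form :: "'e \<Rightarrow> 'e bivec" where
  "local_form \<equiv> bivec_in_chart M \<Lambda> unit_chart"

text \<open>Both partial derivatives of the multiplication at the unit are identities, so
  multiplicativity there says that the value of \<Lambda> equals twice itself.\<close>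

lemma Poisson_unit_zero: "\<Lambda> \<one>\<^bsub>G\<^esub> \<xi> \<eta> = 0"
proof -
  interpret group G by (rule group)
  have "blinfun_apply (components M unit_chart \<one>\<^bsub>G\<^esub>) = (\<lambda>v. v)"
    by (simp add: components_chart_at[OF manifold one_point] fun_eq_iff)
  then have T: "Tmult \<one>\<^bsub>G\<^esub> \<one>\<^bsub>G\<^esub> (u, w) = frechet_derivative mult_expr (at (unit_coords, unit_coords)) (u, w)" for u w
    using components_Tmult[OF one_in_unit_chart one_in_unit_chart, of u w] one_in_unit_chart by simp
  have p: "(\<xi> o\<^sub>L tangent_map_at (product_manifold M M) M mult_map (\<one>\<^bsub>G\<^esub>, \<one>\<^bsub>G\<^esub>)) o\<^sub>L Blinfun (\<lambda>v. (v, 0)) = \<xi>"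
    "(\<xi> o\<^sub>L tangent_map_at (product_manifold M M) M mult_map (\<one>\<^bsub>G\<^esub>, \<one>\<^bsub>G\<^esub>)) o\<^sub>L Blinfun (\<lambda>v. (0, v)) = \<xi>" for \<xi>
    by (rule blinfun_eqI, simp add: Blinfun_Pair_apply T frechet_derivative_mult_expr_unit)+
  have "\<one>\<^bsub>G\<^esub> \<in> carrier G" by simp
  then have "wedge_map (tangent_map_at (product_manifold M M) M mult_map (\<one>\<^bsub>G\<^esub>, \<one>\<^bsub>G\<^esub>))
      (bivec_sum (\<Lambda> \<one>\<^bsub>G\<^esub>) (\<Lambda> \<one>\<^bsub>G\<^esub>)) = \<Lambda> (\<one>\<^bsub>G\<^esub> \<otimes>\<^bsub>G\<^esub> \<one>\<^bsub>G\<^esub>)"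
    using poisson_lie_group unfolding poisson_lie_group_def by blast
  from fun_cong[OF fun_cong[OF this], of \<xi> \<eta>] show ?thesis
    by (simp add: wedge_map_def bivec_sum_def p)
qed

lemma bivector_local_form: "x \<in> chart_image unit_chart \<Longrightarrow> bivector (local_form x)"
  by (rule bivector_bivec_in_chart[OF manifold bivector_field unit_chart_atlas])

lemma smooth_local_form: "smooth_on (chart_image unit_chart) (\<lambda>x. local_form x \<xi> \<eta>)"
  by (rule smooth_on_bivec_in_chart[OF bivector_field unit_chart_atlas])

lemma open_unit_chart_image: "open (chart_image unit_chart)"
  using coordinate_unit_chart by (simp add: coordinate_chart_def)

lemma local_form_unit: "local_form unit_coords \<xi> \<eta> = 0"
  by (simp add: bivec_in_chart_apply[OF coordinate_unit_chart one_in_unit_chart] wedge_map_def Poisson_unit_zero)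

lemma bounded_linear_right_translation:
  assumes "x \<in> inv_dom"
  shows "bounded_linear (\<lambda>a. frechet_derivative mult_expr (at (x, inv_expr x)) (a, 0))"
proof -
  note g = inv_dom_chart_inv[OF assms]
  show ?thesis
    using chart_deriv_bounded_linear[OF chart_deriv_right_translation[OF g(1,2)]] g(3,4,7) one_in_unit_chart by simp
qed

lemma cobracket_eq:
  assumes "is_cobracket G M \<Lambda> \<delta>"
  shows "\<delta> X \<xi> \<eta> = frechet_derivative (\<lambda>x. local_form x \<xi> \<eta>) (at unit_coords) X"
proof -
  define T where "T x = Blinfun (\<lambda>a. frechet_derivative mult_expr (at (x, inv_expr x)) (a, 0))" for x
  have T: "blinfun_apply (T x) a = frechet_derivative mult_expr (at (x, inv_expr x)) (a, 0)" if "x \<in> inv_dom" for x a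
    by (simp add: T_def bounded_linear_Blinfun_apply[OF bounded_linear_right_translation[OF that]])
  \<comment> \<open>\<open>Blinfun\<close> represents the intended map only where that map is
    bounded linear, which is known on \<open>inv_dom\<close>; the limit is therefore transferred on
    this open set.\<close>
  have lim: "((\<lambda>x. blinfun_apply (T x) a) \<longlongrightarrow> a) (at unit_coords)" for a
    by (rule Lim_transform_within_open[OF tendsto_right_translation open_inv_dom unit_coords_mem(2)]) (simp add: T)
  have "((\<lambda>x. wedge_map (T x) (local_form x) \<xi> \<eta>) has_derivative
      (\<lambda>h. frechet_derivative (\<lambda>x. local_form x \<xi> \<eta>) (at unit_coords) h)) (at unit_coords)"
    by (rule vanishing_bivector_family_has_derivative[OF open_unit_chart_image unit_coords_mem(1) bivector_local_form
          smooth_on_has_derivative[OF smooth_local_form unit_coords_mem(1)] local_form_unit lim])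
  then have "((\<lambda>x. right_trivialisation G M \<Lambda> (chart_inv unit_chart x) \<xi> \<eta>) has_derivative
      (\<lambda>h. frechet_derivative (\<lambda>x. local_form x \<xi> \<eta>) (at unit_coords) h)) (at unit_coords)"
    by (rule has_derivative_transform_within_open[OF _ open_inv_dom unit_coords_mem(2)])
       (simp add: right_trivialisation_in_chart T_def)
  moreover have "((\<lambda>x. right_trivialisation G M \<Lambda> (chart_inv unit_chart x) \<xi> \<eta>) has_derivative
      (\<lambda>X. \<delta> X \<xi> \<eta>)) (at unit_coords)"
    using assms by (simp add: is_cobracket_def)
  ultimately show ?thesis using has_derivative_unique by (metis (lifting))
qed

text \<open>\<delta> is given only by its defining property. Linearity in X comes from being a
  derivative, and the values are bivectors because they are derivatives of the bivector-valued local
  form.\<close>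

lemma
  assumes "is_cobracket G M \<Lambda> \<delta>"
  shows bounded_linear_cobracket: "bounded_linear (\<lambda>X. \<delta> X \<xi> \<eta>)"
    and bivector_cobracket: "bivector (\<delta> X)"
proof -
  show "bounded_linear (\<lambda>X. \<delta> X \<xi> \<eta>)"
    using assms unfolding is_cobracket_def by (blast intro: has_derivative_bounded_linear)
  show "bivector (\<delta> X)"
    using bivector_frechet_derivative[OF open_unit_chart_image unit_coords_mem(1) bivector_local_form
        smooth_on_imp_differentiable[OF smooth_local_form unit_coords_mem(1)], of X]
    by (simp flip: cobracket_eq[OF assms])
qed

lemma local_form_has_derivative:
  assumes "is_cobracket G M \<Lambda> \<delta>"
  shows "((\<lambda>x. local_form x \<xi> \<eta>) has_derivative (\<lambda>X. \<delta> X \<xi> \<eta>)) (at unit_coords)"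
  using smooth_on_has_derivative[OF smooth_local_form unit_coords_mem(1), of \<xi> \<eta>]
  unfolding cobracket_eq[OF assms] .

text \<open>The mixed terms depend on the base point alone and differentiate to \<delta>. The
  derivative of the velocity term has a second-derivative part along the velocity, which is 0 at
  (x0, 0), and a first-derivative part, which is \<delta> of the velocity increment.\<close>

lemma lift_local_form_has_derivative:
  assumes \<delta>: "is_cobracket G M \<Lambda> \<delta>"
  shows "((\<lambda>z. lift_in_chart local_form z \<xi> \<eta>) has_derivative (\<lambda>z. lift_in_chart \<delta> z \<xi> \<eta>)) (at (unit_coords, 0))"
proof -
  have f: "((\<lambda>z. local_form (fst z) \<xi> \<eta>) has_derivative (\<lambda>z. \<delta> (fst z) \<xi> \<eta>)) (at (unit_coords, 0::'e))" for \<xi> \<eta>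
    by (rule has_derivative_compose[of fst fst]) (auto intro: has_derivative_fst local_form_has_derivative[OF \<delta>])
  have s: "((\<lambda>z. frechet_derivative (\<lambda>y. local_form y \<xi> \<eta>) (at (fst z)) (snd z)) has_derivative (\<lambda>z. \<delta> (snd z) \<xi> \<eta>))
      (at (unit_coords, 0))" for \<xi> \<eta>
    using frechet_derivative_has_derivative[OF open_unit_chart_image unit_coords_mem(1) smooth_local_form, of \<xi> \<eta> 0]
    by (simp add: second_derivative_zero[OF open_unit_chart_image unit_coords_mem(1) smooth_local_form] flip: cobracket_eq[OF \<delta>])
  show ?thesis
    unfolding lift_in_chart_linear[OF bounded_linear_cobracket[OF \<delta>]]
    unfolding lift_in_chart_def by (intro has_derivative_add f s)
qed

lemma is_cobracket_tangent:
  assumes \<delta>: "is_cobracket G M \<Lambda> \<delta>"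
  shows "is_cobracket (tangent_group G M) (tangent_bundle M) (tangent_lift M \<Lambda>) (lift_in_chart \<delta>)"
proof -
  define tc where "tc = tangent_chart M unit_chart"
  define T where "T z = Blinfun (right_translation_deriv z)" for z
  have c: "chart_at (tangent_bundle M) \<one>\<^bsub>tangent_group G M\<^esub> = tc"
    "snd tc \<one>\<^bsub>tangent_group G M\<^esub> = (unit_coords, 0)"
    by (simp_all add: tangent_group_simps tangent_bundle_def tc_def tangent_chart_def)
  have open_dom: "open (inv_dom \<times> (UNIV::'e set))" and mem: "(unit_coords, 0) \<in> inv_dom \<times> (UNIV::'e set)"
    by (simp_all add: open_Times open_inv_dom unit_coords_mem(2))
  have sub: "inv_dom \<subseteq> chart_image unit_chart" by (auto simp: inv_dom_def chart_image_def)
  have lim: "((\<lambda>z. blinfun_apply (T z) w) \<longlongrightarrow> w) (at (unit_coords, 0))" for w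
    by (rule Lim_transform_within_open[OF tendsto_right_translation_deriv open_dom mem])
       (auto simp: T_def bounded_linear_Blinfun_apply[OF right_trivialisation_tangent_in_chart(2)])
  have biv: "bivector (lift_in_chart local_form z)" if "z \<in> inv_dom \<times> (UNIV::'e set)" for z
  proof (rule bivector_lift_in_chart[OF open_unit_chart_image _ bivector_local_form])
    show z: "fst z \<in> chart_image unit_chart" using that sub by auto
    show "(\<lambda>y. local_form y \<xi> \<eta>) differentiable (at (fst z))" for \<xi> \<eta>
      by (rule smooth_on_imp_differentiable[OF smooth_local_form z])
  qed
  \<comment> \<open>The mixed terms vanish with the local form at the unit, the remaining one
    because the velocity is 0.\<close>
  have zero: "lift_in_chart local_form (unit_coords, 0) \<xi> \<eta> = 0" for \<xi> \<eta>
    using linear_0[OF has_derivative_linear[OF local_form_has_derivative[OF \<delta>]]]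
    by (simp add: lift_in_chart_def local_form_unit flip: cobracket_eq[OF \<delta>])
  \<comment> \<open>Coordinate invariance is applied at all nearby points at once, where the
    preferred charts defining the tangent lift may differ from the unit chart.\<close>
  have lift: "bivec_in_chart (tangent_bundle M) (tangent_lift M \<Lambda>) tc z = lift_in_chart local_form z"
    if "fst z \<in> inv_dom" for z
  proof -
    have z: "z \<in> chart_image tc"
      using that sub unfolding tc_def coordinate_chart_tangent(2)[OF manifold unit_chart_atlas] by (cases z) auto
    obtain g u where gu: "chart_inv tc z = (g, u)" by fastforce
    have "(g, u) \<in> fst tc" "snd tc (g, u) = z"
      using chart_inv_in[OF z] chart_apply_inv[OF z] by (simp_all add: gu)
    then have gz: "g \<in> fst unit_chart" "z = (snd unit_chart g, components M unit_chart g u)"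
      by (auto simp: tc_def tangent_chart_def)
    show ?thesis
      unfolding bivec_in_chart_def[of "tangent_bundle M"] gu
      unfolding tc_def tangent_lift_in_chart[OF manifold bivector_field unit_chart_atlas gz(1)] gz(2) ..
  qed
  show ?thesis
    unfolding is_cobracket_def c
  proof (intro allI)
    fix \<xi> \<eta>
    have "((\<lambda>z. wedge_map (T z) (lift_in_chart local_form z) \<xi> \<eta>) has_derivative (\<lambda>z. lift_in_chart \<delta> z \<xi> \<eta>))
        (at (unit_coords, 0))"
      by (rule vanishing_bivector_family_has_derivative[OF open_dom mem biv lift_local_form_has_derivative[OF \<delta>] zero lim])
    then show "((\<lambda>z. right_trivialisation (tangent_group G M) (tangent_bundle M) (tangent_lift M \<Lambda>) (chart_inv tc z) \<xi> \<eta>)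
        has_derivative (\<lambda>z. lift_in_chart \<delta> z \<xi> \<eta>)) (at (unit_coords, 0))"
      by (rule has_derivative_transform_within_open[OF _ open_dom mem])
         (auto simp: T_def right_trivialisation_tangent_in_chart(1)[folded tc_def] lift)
  qed
qed

end

theorem theorem8p1:
  fixes G :: "'p monoid"
    and M :: "('p, 'e::euclidean_space) manifold"
    and \<Lambda> :: "'p \<Rightarrow> 'e bivec"
    and \<delta> :: "'e \<Rightarrow> 'e bivec"
  assumes "poisson_lie_group G M \<Lambda>"
    and "is_cobracket G M \<Lambda> \<delta>"
  shows "linear (tangent_lie_algebra_iso G M) \<and> bij (tangent_lie_algebra_iso G M) \<and>
      is_cobracket (tangent_group G M) (tangent_bundle M) (tangent_lift M \<Lambda>)
        (transport_cobracket (tangent_lie_algebra_iso G M) (tangent_lift vector_space_manifold \<delta>)) \<and>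
      (\<forall>\<alpha> \<beta>.
        dual_bracket (tangent_lift vector_space_manifold \<delta>) (tangent_dual_iso \<alpha>) (tangent_dual_iso \<beta>)
        = tangent_dual_iso (tangent_bracket (dual_bracket \<delta>) \<alpha> \<beta>))"
proof -
  interpret poisson_group G M \<Lambda> by unfold_locales (rule assms(1))
  note lin = bounded_linear_cobracket[OF assms(2)]
  have lift: "tangent_lift vector_space_manifold \<delta> = lift_in_chart \<delta>"
    by (rule tangent_lift_vector_space[OF bivector_cobracket[OF assms(2)] lin])
  have id: "Blinfun (\<lambda>z. z) = (id_blinfun :: ('e \<times> 'e) \<Rightarrow>\<^sub>L ('e \<times> 'e))"
    by (rule blinfun_eqI) (simp add: bounded_linear_Blinfun_apply bounded_linear_ident)
  \<comment> \<open>Transport along the identity changes nothing, so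
    \<open>lift_in_chart \<delta>\<close> itself is the transported cobracket.\<close>
  have "transport_cobracket (tangent_lie_algebra_iso G M) (lift_in_chart \<delta>) = lift_in_chart \<delta>"
    by (simp add: transport_cobracket_def tangent_lie_algebra_iso_id id wedge_map_id inv_id[unfolded id_def] fun_eq_iff)
  then show ?thesis
    using is_cobracket_tangent[OF assms(2)] dual_bracket_lift_in_chart[OF lin]
    by (simp add: lift tangent_lie_algebra_iso_id linear_ident bij_id[unfolded id_def])
qed

end
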